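(* A matrix $A\in\mathbb{R}^{n\times n}$ is dissipative Hamiltonian if and only if all of the following conditions are satisfied: (i) $\sigma(A)\subset\{\lambda\in\mathbb{C}:\operatorname{Re}\lambda\le0\}$; (ii) $\ker\big((A-i\alpha)^2\big)=\ker(A-i\alpha)$ for all $\alpha\in\mathbb{R}\setminus\{0\}$; (iii) $\ker A^3=\ker A^2$. If $A=(J-R)Q$ with $J,R,Q\in\mathbb{R}^{n\times n}$, $J=-J^\top$, $R=R^\top\ge0$, $Q=Q^\top\ge0$, then for $\alpha\in\mathbb{R}\setminus\{0\}$ $$\ker\big((A-i\alpha)^2\big)=\ker(A-i\alpha)=\ker(JQ-i\alpha)\cap\ker(RQ).$$ Moreover, $\ker A=\ker(JQ)\cap\ker(RQ)$ and $$\ker A^3=\ker A^2=\ker(QJQ)\cap\ker(RQ).$$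
   Context: A matrix $A\in\mathbb{R}^{n\times n}$ is called dissipative Hamiltonian if $A=(J-R)Q$ for some $J,R,Q\in\mathbb{R}^{n\times n}$ with $J=-J^\top$, $R=R^\top\ge0$, $Q=Q^\top\ge0$ (positive semi-definite). $\sigma(A)$ is the set of (complex) eigenvalues; kernels of matrices involving $i\alpha$ are taken in $\mathbb{C}^n$. *)

theory Defs
  imports
    "Jordan_Normal_Form.Matrix_Kernel"
    "Jordan_Normal_Form.Spectral_Radius"
    Complex_Main
begin

definition symmetric_mat :: "real mat \<Rightarrow> bool" where
  "symmetric_mat M \<longleftrightarrow> M\<^sup>T = M"

definition skew_symmetric_mat :: "real mat \<Rightarrow> bool" where
  "skew_symmetric_mat M \<longleftrightarrow> M\<^sup>T = - M"

definition sym_pos_semidef :: "nat \<Rightarrow> real mat \<Rightarrow> bool" where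
  "sym_pos_semidef n M \<longleftrightarrow> M \<in> carrier_mat n n \<and> symmetric_mat M \<and>
     (\<forall>x \<in> carrier_vec n. 0 \<le> x \<bullet> (M *\<^sub>v x))"

definition dH_decomposition :: "nat \<Rightarrow> real mat \<Rightarrow> real mat \<Rightarrow> real mat \<Rightarrow> real mat \<Rightarrow> bool" where
  "dH_decomposition n A J R Q \<longleftrightarrow>
     J \<in> carrier_mat n n \<and> skew_symmetric_mat J \<and>
     sym_pos_semidef n R \<and> sym_pos_semidef n Q \<and>
     A = (J - R) * Q"

definition dissipative_Hamiltonian :: "nat \<Rightarrow> real mat \<Rightarrow> bool" where
  "dissipative_Hamiltonian n A \<longleftrightarrow> (\<exists>J R Q. dH_decomposition n A J R Q)"

abbreviation cmat :: "real mat \<Rightarrow> complex mat" where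
  "cmat M \<equiv> map_mat complex_of_real M"

text \<open>\<open>M - i \<alpha> I\<close> as a complex matrix, so that its kernel is a subspace of the complex
  vector space; kernels of real matrices are real subspaces unless \<open>cmat\<close> is applied.\<close>

definition shift_mat :: "nat \<Rightarrow> real mat \<Rightarrow> real \<Rightarrow> complex mat" where
  "shift_mat n M \<alpha> = cmat M - (\<i> * complex_of_real \<alpha>) \<cdot>\<^sub>m 1\<^sub>m n"

end

(* Necessity: Q A has dissipation -(Q x)^* R (Q x), so an eigenvector of A on the imaginary axis is
   lossless, and testing a Jordan chain against Q shows that Q annihilates its image under A - i alpha.
   Sufficiency: A = (J - R) Q as soon as some Q >= 0 satisfies ker Q <= ker A and x^T Q A x <= 0 (a
   symmetric generalized inverse of Q then yields J and R). Such a Q is a weighted sum of the squared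
   moduli of the coordinates in a complex Jordan basis, with weights growing geometrically along each
   block; the three conditions say that on the imaginary axis only eigenvalue 0 has
   nontrivial blocks, and these have size at most 2. *)

theory Submission
  imports Defs "Jordan_Normal_Form.Gauss_Jordan_Elimination"
begin

text \<open>With diagonal weights, the two demands on \<open>Q\<close> in the converse pull against
  each other. For ker Q to lie in ker A, every coordinate that \<open>A\<close> reads needs positive
  weight: each coordinate with a nonzero eigenvalue and each target of a superdiagonal link.
  Conversely, a link leaving a coordinate of positive weight contributes a cross term of either sign
  to the form of \<open>Q A\<close>, which only decay can compensate. For Re lambda < 0 there is
  decay, and it suffices that consecutive weights have a ratio of at least 1 / (Re lambda)^2. On the
  imaginary axis there is none, so the source of a link must have weight 0. At eigenvalue 0 this is
  possible when the source is not itself a target, that is, in blocks of size at most 2; at i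
  \<alpha> with \<alpha> \<noteq> 0 it is impossible, and there no link may occur at all.\<close>

section \<open>Quadratic forms of real matrices on complex vectors\<close>

text \<open>This is the real part of the Hermitian product, or the Euclidean product of R^(2n). It
  splits over real and imaginary parts, so that semidefiniteness over real vectors carries over to
  complex ones; in return, the factor i has to be moved across by separate rules.\<close>

definition real_inner :: "complex vec \<Rightarrow> complex vec \<Rightarrow> real" where
  "real_inner v w = (\<Sum>i\<in>{0..<dim_vec w}. Re (v $ i) * Re (w $ i) + Im (v $ i) * Im (w $ i))"

lemma real_inner_commute:
  "v \<in> carrier_vec n \<Longrightarrow> w \<in> carrier_vec n \<Longrightarrow> real_inner v w = real_inner w v"
  unfolding real_inner_def by (auto simp: ac_simps)

lemma real_inner_minus_right:
  "u \<in> carrier_vec n \<Longrightarrow> v \<in> carrier_vec n \<Longrightarrow> w \<in> carrier_vec n \<Longrightarrow>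
    real_inner u (v - w) = real_inner u v - real_inner u w"
  unfolding real_inner_def by (auto simp: sum_subtractf sum.distrib algebra_simps)

lemma real_inner_smult_right:
  "real_inner u (z \<cdot>\<^sub>v v) = Re z * real_inner u v + Im z * real_inner u (\<i> \<cdot>\<^sub>v v)"
  unfolding real_inner_def by (simp add: sum_distrib_left sum.distrib sum_subtractf algebra_simps)

lemma real_inner_imag_unit_left:
  "u \<in> carrier_vec n \<Longrightarrow> v \<in> carrier_vec n \<Longrightarrow>
    real_inner (\<i> \<cdot>\<^sub>v u) v = - real_inner u (\<i> \<cdot>\<^sub>v v)"
  unfolding real_inner_def sum_negf[symmetric] by (auto intro!: sum.cong)

lemma real_inner_zero [simp]: "real_inner u (0\<^sub>v n) = 0"
  unfolding real_inner_def by auto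

lemma real_inner_Re_Im:
  "v \<in> carrier_vec n \<Longrightarrow> w \<in> carrier_vec n \<Longrightarrow>
    real_inner v w = map_vec Re v \<bullet> map_vec Re w + map_vec Im v \<bullet> map_vec Im w"
  unfolding real_inner_def scalar_prod_def by (auto simp: sum.distrib)

lemma Re_cmat_mult_vec:
  assumes "M \<in> carrier_mat m n" "v \<in> carrier_vec n"
  shows "map_vec Re (cmat M *\<^sub>v v) = M *\<^sub>v map_vec Re v"
  using assms by (intro eq_vecI) (auto simp: scalar_prod_def)

lemma Im_cmat_mult_vec:
  assumes "M \<in> carrier_mat m n" "v \<in> carrier_vec n"
  shows "map_vec Im (cmat M *\<^sub>v v) = M *\<^sub>v map_vec Im v"
  using assms by (intro eq_vecI) (auto simp: scalar_prod_def)

lemma complex_vec_eq_0_iff: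
  "v \<in> carrier_vec n \<Longrightarrow> v = 0\<^sub>v n \<longleftrightarrow> map_vec Re v = 0\<^sub>v n \<and> map_vec Im v = 0\<^sub>v n"
  by (auto simp: vec_eq_iff complex_eq_iff)

lemma cmat_mult: "M \<in> carrier_mat k m \<Longrightarrow> N \<in> carrier_mat m n \<Longrightarrow> cmat (M * N) = cmat M * cmat N"
  by (rule of_real_hom.mat_hom_mult)

lemma cmat_minus: "M \<in> carrier_mat m n \<Longrightarrow> N \<in> carrier_mat m n \<Longrightarrow> cmat (M - N) = cmat M - cmat N"
  by (intro eq_matI) auto

lemma real_inner_cmat:
  assumes M: "M \<in> carrier_mat m n" and v: "v \<in> carrier_vec n" and w: "w \<in> carrier_vec m"
  shows "real_inner w (cmat M *\<^sub>v v) = real_inner (cmat (M\<^sup>T) *\<^sub>v w) v"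
proof -
  have "M\<^sup>T \<in> carrier_mat n m" using M by simp
  then show ?thesis
    using assms
    by (subst (1 2) real_inner_Re_Im)
      (auto simp: Re_cmat_mult_vec[of _ m n] Im_cmat_mult_vec[of _ m n] Re_cmat_mult_vec[of _ n m]
        Im_cmat_mult_vec[of _ n m] transpose_vec_mult_scalar[of _ m n])
qed

lemma sym_pos_semidefD:
  assumes "sym_pos_semidef n M"
  shows "M \<in> carrier_mat n n" "M\<^sup>T = M" "x \<in> carrier_vec n \<Longrightarrow> 0 \<le> x \<bullet> (M *\<^sub>v x)"
  using assms unfolding sym_pos_semidef_def symmetric_mat_def by auto

text \<open>In the direction \<open>y = M x\<close> the form at \<open>x + t y\<close> equals 2 t
  |y|^2 + t^2 (y . M y). If \<open>y\<close> were nonzero, this would be negative for small negative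
  \<open>t\<close>.\<close>

lemma sym_pos_semidef_form_eq_0:
  assumes M: "sym_pos_semidef n M" and x: "x \<in> carrier_vec n" and 0: "x \<bullet> (M *\<^sub>v x) = 0"
  shows "M *\<^sub>v x = 0\<^sub>v n"
proof -
  note MD = sym_pos_semidefD[OF M]
  define y where "y = M *\<^sub>v x"
  have y: "y \<in> carrier_vec n" using MD x by (auto simp: y_def)
  have My: "M *\<^sub>v y \<in> carrier_vec n" using MD y by auto
  have sym: "x \<bullet> (M *\<^sub>v y) = y \<bullet> y"
    using transpose_vec_mult_scalar[OF MD(1) y x] unfolding MD(2) y_def by simp
  have quad: "0 \<le> 2 * t * (y \<bullet> y) + t * t * (y \<bullet> (M *\<^sub>v y))" for t
  proof -
    have "0 \<le> (x + t \<cdot>\<^sub>v y) \<bullet> (M *\<^sub>v (x + t \<cdot>\<^sub>v y))"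
      using MD(3) x y by auto
    also have "M *\<^sub>v (x + t \<cdot>\<^sub>v y) = y + t \<cdot>\<^sub>v (M *\<^sub>v y)"
      using MD(1) x y by (simp add: mult_add_distrib_mat_vec mult_mat_vec y_def)
    also have "(x + t \<cdot>\<^sub>v y) \<bullet> (y + t \<cdot>\<^sub>v (M *\<^sub>v y)) =
        2 * t * (y \<bullet> y) + t * t * (y \<bullet> (M *\<^sub>v y))"
      using x y My 0 sym
      by (simp add: add_scalar_prod_distrib[of _ n] scalar_prod_add_distrib[of _ n] y_def[symmetric]
          algebra_simps)
    finally show ?thesis .
  qed
  define c where "c = y \<bullet> (M *\<^sub>v y)"
  have c: "0 \<le> c" using MD(3)[OF y] by (simp add: c_def)
  have "y \<bullet> y \<le> 0"
  proof (rule ccontr)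
    assume "\<not> y \<bullet> y \<le> 0"
    then have p: "y \<bullet> y > 0" by simp
    \<comment> \<open>The minimizer of the quadratic is - |y|^2 / c; the denominator
      \<open>c + 1\<close> also covers \<open>c = 0\<close> and keeps the value negative.\<close>
    define t where "t = - (y \<bullet> y) / (c + 1)"
    have "2 * t * (y \<bullet> y) + t * t * c = t * (2 * (y \<bullet> y) + t * c)" by (simp add: algebra_simps)
    moreover have "t < 0" using p c by (simp add: t_def divide_neg_pos)
    moreover have "2 * (y \<bullet> y) + t * c > 0"
    proof -
      have "t * c \<ge> - (y \<bullet> y)" using p c by (simp add: t_def field_simps)
      then show ?thesis using p by simp
    qed
    ultimately have "2 * t * (y \<bullet> y) + t * t * c < 0" by (simp add: mult_neg_pos)
    with quad[of t] show False by (simp add: c_def)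
  qed
  moreover have "0 \<le> y \<bullet> y" unfolding scalar_prod_def by (auto intro: sum_nonneg)
  ultimately have "y \<bullet>c y = 0" by simp
  then have "y = 0\<^sub>v n" using y conjugate_square_eq_0_vec[OF y] by simp
  then show ?thesis by (simp add: y_def)
qed

text \<open>The value at \<open>v\<close> is the sum of the real forms at its real and imaginary
  parts, two nonnegative terms, so if the sum vanishes then both do.\<close>

lemma sym_pos_semidef_real_inner:
  assumes M: "sym_pos_semidef n M" and v: "v \<in> carrier_vec n"
  shows "0 \<le> real_inner v (cmat M *\<^sub>v v)"
    and "real_inner v (cmat M *\<^sub>v v) = 0 \<Longrightarrow> cmat M *\<^sub>v v = 0\<^sub>v n"
proof -
  note MD = sym_pos_semidefD[OF M]
  have Mv: "cmat M *\<^sub>v v \<in> carrier_vec n" using MD(1) v by auto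
  have eq: "real_inner v (cmat M *\<^sub>v v) = map_vec Re v \<bullet> (M *\<^sub>v map_vec Re v) + map_vec Im v \<bullet> (M *\<^sub>v map_vec Im v)"
    using real_inner_Re_Im[OF v Mv] Re_cmat_mult_vec[OF MD(1) v] Im_cmat_mult_vec[OF MD(1) v] by simp
  have nn: "0 \<le> map_vec Re v \<bullet> (M *\<^sub>v map_vec Re v)" "0 \<le> map_vec Im v \<bullet> (M *\<^sub>v map_vec Im v)"
    using MD(3) v by auto
  then show "0 \<le> real_inner v (cmat M *\<^sub>v v)" using eq by simp
  assume "real_inner v (cmat M *\<^sub>v v) = 0"
  then have "map_vec Re v \<bullet> (M *\<^sub>v map_vec Re v) = 0" "map_vec Im v \<bullet> (M *\<^sub>v map_vec Im v) = 0"
    using eq nn by auto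
  then have "M *\<^sub>v map_vec Re v = 0\<^sub>v n" "M *\<^sub>v map_vec Im v = 0\<^sub>v n"
    using sym_pos_semidef_form_eq_0[OF M] v by auto
  then show "cmat M *\<^sub>v v = 0\<^sub>v n"
    using complex_vec_eq_0_iff[OF Mv] Re_cmat_mult_vec[OF MD(1) v] Im_cmat_mult_vec[OF MD(1) v] by simp
qed

abbreviation cvec :: "real vec \<Rightarrow> complex vec" where
  "cvec \<equiv> map_vec complex_of_real"

lemma cmat_mult_cvec:
  "M \<in> carrier_mat m n \<Longrightarrow> x \<in> carrier_vec n \<Longrightarrow> cmat M *\<^sub>v cvec x = cvec (M *\<^sub>v x)"
  by (rule of_real_hom.mult_mat_vec_hom[symmetric])

lemma cvec_eq_0_iff: "cvec x = 0\<^sub>v n \<longleftrightarrow> x = 0\<^sub>v n"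
  by (auto simp: vec_eq_iff)

lemma zero_smult_vec: "v \<in> carrier_vec n \<Longrightarrow> (0 :: complex) \<cdot>\<^sub>v v = 0\<^sub>v n"
  by (intro eq_vecI) auto

text \<open>The number v^* M v is real: moving \<open>M\<close> across the product keeps the sign
  and moving i flips it, so the quantity is its own negative.\<close>

lemma real_inner_sym_imag_unit:
  assumes M: "M \<in> carrier_mat n n" "M\<^sup>T = M" and v: "v \<in> carrier_vec n"
  shows "real_inner (cmat M *\<^sub>v v) (\<i> \<cdot>\<^sub>v v) = 0"
proof -
  have M': "cmat M \<in> carrier_mat n n" and Mv: "cmat M *\<^sub>v v \<in> carrier_vec n" using M v by auto
  have "real_inner (cmat M *\<^sub>v v) (\<i> \<cdot>\<^sub>v v) = real_inner v (cmat M *\<^sub>v (\<i> \<cdot>\<^sub>v v))"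
    using real_inner_cmat[OF M(1) _ v, of "\<i> \<cdot>\<^sub>v v"] v M(2) by simp
  also have "\<dots> = real_inner v (\<i> \<cdot>\<^sub>v (cmat M *\<^sub>v v))"
    using mult_mat_vec[OF M' v] by simp
  also have "\<dots> = - real_inner (\<i> \<cdot>\<^sub>v v) (cmat M *\<^sub>v v)"
    using real_inner_imag_unit_left[OF v Mv] by simp
  also have "\<dots> = - real_inner (cmat M *\<^sub>v v) (\<i> \<cdot>\<^sub>v v)"
    using real_inner_commute[of _ n] v Mv by simp
  finally show ?thesis by simp
qed

section \<open>Necessity: the energy balance of a decomposition (J - R) Q\<close>

context
  fixes n :: nat and A J R Q :: "real mat"
  assumes dH: "dH_decomposition n A J R Q"
begin

lemma dH_carrier:
  "J \<in> carrier_mat n n" "R \<in> carrier_mat n n" "Q \<in> carrier_mat n n" "A \<in> carrier_mat n n"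
  and dH_transpose: "J\<^sup>T = - J" "R\<^sup>T = R" "Q\<^sup>T = Q"
  and dH_psd: "sym_pos_semidef n R" "sym_pos_semidef n Q"
  using dH unfolding dH_decomposition_def sym_pos_semidef_def skew_symmetric_mat_def symmetric_mat_def
  by auto

lemma dH_cmat_carrier [simp]:
  "cmat J \<in> carrier_mat n n" "cmat R \<in> carrier_mat n n" "cmat Q \<in> carrier_mat n n"
  "cmat A \<in> carrier_mat n n"
  using dH_carrier by auto

lemma dH_mult_carrier [simp]:
  assumes "v \<in> carrier_vec n"
  shows "cmat J *\<^sub>v v \<in> carrier_vec n" "cmat R *\<^sub>v v \<in> carrier_vec n"
    "cmat Q *\<^sub>v v \<in> carrier_vec n" "cmat A *\<^sub>v v \<in> carrier_vec n"
  using assms dH_cmat_carrier by (meson mult_mat_vec_carrier)+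

lemma dH_mult_zero:
  "cmat J *\<^sub>v 0\<^sub>v n = 0\<^sub>v n" "cmat R *\<^sub>v 0\<^sub>v n = 0\<^sub>v n" "cmat A *\<^sub>v 0\<^sub>v n = 0\<^sub>v n"
  using dH_carrier by (auto intro!: eq_vecI)

lemma dH_mult_vec:
  assumes v: "v \<in> carrier_vec n"
  shows "cmat A *\<^sub>v v = cmat J *\<^sub>v (cmat Q *\<^sub>v v) - cmat R *\<^sub>v (cmat Q *\<^sub>v v)"
proof -
  have "cmat A = (cmat J - cmat R) * cmat Q"
    using dH dH_carrier cmat_mult[OF minus_carrier_mat[OF dH_carrier(2)] dH_carrier(3), of J]
      cmat_minus[of J n n R]
    unfolding dH_decomposition_def by simp
  then show ?thesis
    using v minus_mult_distrib_mat_vec[OF dH_cmat_carrier(1,2) dH_mult_carrier(3)[OF v]]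
      assoc_mult_mat_vec[OF minus_carrier_mat[OF dH_cmat_carrier(2)] dH_cmat_carrier(3) v]
    by simp
qed

lemma real_inner_J:
  assumes u: "u \<in> carrier_vec n" and v: "v \<in> carrier_vec n"
  shows "real_inner u (cmat J *\<^sub>v v) = - real_inner (cmat J *\<^sub>v u) v"
proof -
  have "cmat (- J) *\<^sub>v u = - (cmat J *\<^sub>v u)"
    using dH_carrier u by (intro eq_vecI) (auto simp: scalar_prod_def sum_negf[symmetric])
  then have "real_inner u (cmat J *\<^sub>v v) = real_inner (- (cmat J *\<^sub>v u)) v"
    using real_inner_cmat[OF dH_carrier(1) v u] dH_transpose by simp
  also have "\<dots> = - real_inner (cmat J *\<^sub>v u) v"
    using u v dH_carrier by (auto simp: real_inner_def sum.distrib sum_negf sum_subtractf)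
  finally show ?thesis .
qed

text \<open>This is the energy balance in polarized form. \<open>J\<close> and \<open>R\<close> are
  moved onto \<open>w\<close> because in the chain arguments \<open>J Q w\<close> and
  \<open>R Q w\<close> are under control while \<open>v\<close> is arbitrary.\<close>

lemma dH_real_inner:
  assumes w: "w \<in> carrier_vec n" and v: "v \<in> carrier_vec n"
  shows "real_inner (cmat Q *\<^sub>v w) (cmat A *\<^sub>v v) =
    - real_inner (cmat J *\<^sub>v (cmat Q *\<^sub>v w)) (cmat Q *\<^sub>v v)
    - real_inner (cmat R *\<^sub>v (cmat Q *\<^sub>v w)) (cmat Q *\<^sub>v v)"
  using v w real_inner_cmat[OF dH_carrier(2), of "cmat Q *\<^sub>v v" "cmat Q *\<^sub>v w"] dH_transpose(2)
  by (simp add: dH_mult_vec real_inner_minus_right[of _ n] real_inner_J)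

lemma dH_real_inner_self:
  assumes v: "v \<in> carrier_vec n"
  shows "real_inner (cmat Q *\<^sub>v v) (cmat A *\<^sub>v v) =
    - real_inner (cmat Q *\<^sub>v v) (cmat R *\<^sub>v (cmat Q *\<^sub>v v))"
proof -
  let ?q = "cmat Q *\<^sub>v v"
  have q: "?q \<in> carrier_vec n" using v by simp
  show ?thesis
    using dH_real_inner[OF v v] real_inner_J[OF q q]
      real_inner_commute[OF dH_mult_carrier(1)[OF q] q] real_inner_commute[OF dH_mult_carrier(2)[OF q] q]
    by linarith
qed

lemma dH_lossless:
  assumes v: "v \<in> carrier_vec n" and "real_inner (cmat Q *\<^sub>v v) (cmat A *\<^sub>v v) = 0"
  shows "cmat R *\<^sub>v (cmat Q *\<^sub>v v) = 0\<^sub>v n"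
    and "cmat A *\<^sub>v v = cmat J *\<^sub>v (cmat Q *\<^sub>v v)"
proof -
  show *: "cmat R *\<^sub>v (cmat Q *\<^sub>v v) = 0\<^sub>v n"
    using assms dH_real_inner_self[OF v] sym_pos_semidef_real_inner(2)[OF dH_psd(1), of "cmat Q *\<^sub>v v"]
    by simp
  show "cmat A *\<^sub>v v = cmat J *\<^sub>v (cmat Q *\<^sub>v v)"
    using * v by (simp add: dH_mult_vec)
qed

text \<open>Since v^* Q v is real, its multiple by i \<alpha> has no real part, so the energy
  balance at \<open>v\<close> is zero. This includes \<open>\<alpha> = 0\<close>.\<close>

lemma dH_imaginary_eigenvector:
  assumes v: "v \<in> carrier_vec n" and ev: "cmat A *\<^sub>v v = (\<i> * complex_of_real \<alpha>) \<cdot>\<^sub>v v"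
  shows "cmat R *\<^sub>v (cmat Q *\<^sub>v v) = 0\<^sub>v n"
    and "cmat J *\<^sub>v (cmat Q *\<^sub>v v) = (\<i> * complex_of_real \<alpha>) \<cdot>\<^sub>v v"
proof -
  have "real_inner (cmat Q *\<^sub>v v) (cmat A *\<^sub>v v) = 0"
    unfolding ev using real_inner_sym_imag_unit[OF dH_carrier(3) dH_transpose(3) v]
    by (subst real_inner_smult_right) simp
  from dH_lossless[OF v this] ev
  show "cmat R *\<^sub>v (cmat Q *\<^sub>v v) = 0\<^sub>v n"
    and "cmat J *\<^sub>v (cmat Q *\<^sub>v v) = (\<i> * complex_of_real \<alpha>) \<cdot>\<^sub>v v"
    by auto
qed

text \<open>Because \<open>J Q w\<close> is i \<alpha> w and \<open>R Q w\<close> vanishes, pairing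
  \<open>Q w\<close> with \<open>A v\<close> gives the same as pairing it with i \<alpha> v. So
  \<open>Q w\<close> is orthogonal to the difference, which is \<open>w\<close>, and
  semidefiniteness gives \<open>Q w = 0\<close>. The conclusion concerns \<open>Q w\<close> and not
  \<open>w\<close>, since \<open>\<alpha> = 0\<close> is included and blocks of size 2 do occur
  there.\<close>

lemma dH_imaginary_chain:
  assumes v: "v \<in> carrier_vec n"
    and w: "w = cmat A *\<^sub>v v - (\<i> * complex_of_real \<alpha>) \<cdot>\<^sub>v v"
    and ev: "cmat A *\<^sub>v w = (\<i> * complex_of_real \<alpha>) \<cdot>\<^sub>v w"
  shows "cmat Q *\<^sub>v w = 0\<^sub>v n"
proof -
  have wc: "w \<in> carrier_vec n" using v by (auto simp: w)
  note * = dH_imaginary_eigenvector[OF wc ev]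
  have "real_inner (cmat Q *\<^sub>v w) (cmat A *\<^sub>v v) =
      - real_inner (cmat J *\<^sub>v (cmat Q *\<^sub>v w)) (cmat Q *\<^sub>v v)"
    using dH_real_inner[OF wc v] * v real_inner_commute[of "0\<^sub>v n" n "cmat Q *\<^sub>v v"] by simp
  also have "\<dots> = - real_inner (cmat Q *\<^sub>v v) ((\<i> * complex_of_real \<alpha>) \<cdot>\<^sub>v w)"
    unfolding *(2) using real_inner_commute[of "(\<i> * complex_of_real \<alpha>) \<cdot>\<^sub>v w" n "cmat Q *\<^sub>v v"] v wc by simp
  also have "\<dots> = - \<alpha> * real_inner (cmat Q *\<^sub>v v) (\<i> \<cdot>\<^sub>v w)"
    by (subst real_inner_smult_right) simp
  \<comment> \<open>The sign produced by moving i cancels the one from the skewness of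
    \<open>J\<close>.\<close>
  also have "real_inner (cmat Q *\<^sub>v v) (\<i> \<cdot>\<^sub>v w) = - real_inner (\<i> \<cdot>\<^sub>v (cmat Q *\<^sub>v v)) w"
    using real_inner_imag_unit_left[of "cmat Q *\<^sub>v v" n w] v wc by simp
  also have "\<i> \<cdot>\<^sub>v (cmat Q *\<^sub>v v) = cmat Q *\<^sub>v (\<i> \<cdot>\<^sub>v v)"
    using mult_mat_vec[OF dH_cmat_carrier(3) v] by simp
  also have "real_inner (cmat Q *\<^sub>v (\<i> \<cdot>\<^sub>v v)) w = real_inner (\<i> \<cdot>\<^sub>v v) (cmat Q *\<^sub>v w)"
    using real_inner_cmat[OF dH_carrier(3) wc, of "\<i> \<cdot>\<^sub>v v"] v dH_transpose(3) by simp
  also have "\<dots> = real_inner (cmat Q *\<^sub>v w) (\<i> \<cdot>\<^sub>v v)"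
    using real_inner_commute[of "\<i> \<cdot>\<^sub>v v" n "cmat Q *\<^sub>v w"] v wc by simp
  finally have "real_inner (cmat Q *\<^sub>v w) w = 0"
    using real_inner_smult_right[of "cmat Q *\<^sub>v w" "\<i> * complex_of_real \<alpha>" v] v wc
    by (subst w) (simp add: real_inner_minus_right[of _ n])
  then show ?thesis
    using sym_pos_semidef_real_inner(2)[OF dH_psd(2) wc] real_inner_commute[of w n "cmat Q *\<^sub>v w"] wc
    by simp
qed

text \<open>If \<open>Q A v = 0\<close>, the pairing of \<open>Q v\<close> with \<open>A v\<close>,
  which is that of \<open>v\<close> with \<open>Q A v\<close>, vanishes. So \<open>v\<close> is
  lossless and \<open>A v\<close> reduces to \<open>J Q v\<close>.\<close>

lemma dH_QA_kernel:
  assumes v: "v \<in> carrier_vec n"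
  shows "cmat Q *\<^sub>v (cmat A *\<^sub>v v) = 0\<^sub>v n \<longleftrightarrow>
    cmat R *\<^sub>v (cmat Q *\<^sub>v v) = 0\<^sub>v n \<and> cmat Q *\<^sub>v (cmat J *\<^sub>v (cmat Q *\<^sub>v v)) = 0\<^sub>v n"
    (is "?l \<longleftrightarrow> ?r")
proof
  assume l: ?l
  have "real_inner (cmat Q *\<^sub>v v) (cmat A *\<^sub>v v) = 0"
    using real_inner_cmat[OF dH_carrier(3), of "cmat A *\<^sub>v v" v] v l dH_transpose(3) by simp
  from dH_lossless[OF v this] l show ?r by simp
next
  assume ?r
  then show ?l using v by (simp add: dH_mult_vec)
qed

text \<open>For \<open>w = A v\<close> both \<open>R Q w\<close> and \<open>Q J Q w\<close> vanish,
  so the polarized balance makes \<open>Q w\<close> orthogonal to \<open>A v = w\<close>. This is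
  what collapses ker A^3 to ker A^2.\<close>

lemma dH_QAA_kernel:
  assumes v: "v \<in> carrier_vec n"
    and 0: "cmat Q *\<^sub>v (cmat A *\<^sub>v (cmat A *\<^sub>v v)) = 0\<^sub>v n"
  shows "cmat Q *\<^sub>v (cmat A *\<^sub>v v) = 0\<^sub>v n"
proof -
  define w where "w = cmat A *\<^sub>v v"
  have w: "w \<in> carrier_vec n" using v by (simp add: w_def)
  have *: "cmat R *\<^sub>v (cmat Q *\<^sub>v w) = 0\<^sub>v n" "cmat Q *\<^sub>v (cmat J *\<^sub>v (cmat Q *\<^sub>v w)) = 0\<^sub>v n"
    using dH_QA_kernel[OF w] 0 by (auto simp: w_def)
  have "real_inner (cmat J *\<^sub>v (cmat Q *\<^sub>v w)) (cmat Q *\<^sub>v v) = 0"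
    using real_inner_cmat[OF dH_carrier(3) v, of "cmat J *\<^sub>v (cmat Q *\<^sub>v w)"] * w dH_transpose(3)
      real_inner_commute[of "0\<^sub>v n" n v] v by simp
  then have "real_inner (cmat Q *\<^sub>v w) w = 0"
    using dH_real_inner[OF w v] * v real_inner_commute[of "0\<^sub>v n" n "cmat Q *\<^sub>v v"]
    by (simp add: w_def)
  then show ?thesis
    using sym_pos_semidef_real_inner(2)[OF dH_psd(2) w] real_inner_commute[of w n "cmat Q *\<^sub>v w"] w
    by (simp add: w_def)
qed

lemma dH_A_Q_kernel:
  assumes "v \<in> carrier_vec n" "cmat Q *\<^sub>v v = 0\<^sub>v n"
  shows "cmat A *\<^sub>v v = 0\<^sub>v n"
  using assms dH_mult_zero by (simp add: dH_mult_vec)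

text \<open>One direction is the chain argument at \<open>\<alpha> = 0\<close>, the other is that
  ker Q lies in ker A. Thus ker A^2 = ker QA, which \<open>dH_QA_kernel\<close> expresses through
  \<open>Q J Q\<close> and \<open>R Q\<close>.\<close>

lemma dH_AA_kernel:
  assumes v: "v \<in> carrier_vec n"
  shows "cmat A *\<^sub>v (cmat A *\<^sub>v v) = 0\<^sub>v n \<longleftrightarrow> cmat Q *\<^sub>v (cmat A *\<^sub>v v) = 0\<^sub>v n"
proof
  assume "cmat A *\<^sub>v (cmat A *\<^sub>v v) = 0\<^sub>v n"
  then show "cmat Q *\<^sub>v (cmat A *\<^sub>v v) = 0\<^sub>v n"
    using dH_imaginary_chain[OF v, of "cmat A *\<^sub>v v" 0] v by (simp add: zero_smult_vec[of _ n])
qed (use v dH_A_Q_kernel in auto)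

lemma dH_AAA_kernel:
  assumes v: "v \<in> carrier_vec n"
  shows "cmat A *\<^sub>v (cmat A *\<^sub>v (cmat A *\<^sub>v v)) = 0\<^sub>v n \<longleftrightarrow> cmat A *\<^sub>v (cmat A *\<^sub>v v) = 0\<^sub>v n"
proof
  assume "cmat A *\<^sub>v (cmat A *\<^sub>v (cmat A *\<^sub>v v)) = 0\<^sub>v n"
  then show "cmat A *\<^sub>v (cmat A *\<^sub>v v) = 0\<^sub>v n"
    using dH_QAA_kernel[OF v] v dH_AA_kernel by auto
qed (simp add: dH_mult_zero)

text \<open>The balance reads Re z * q \<le> 0 with q = v^* Q v \<ge> 0. In the degenerate case q =
  0 the eigenvector lies in ker Q, hence in ker A, and z = 0.\<close>

lemma dH_spectrum: "spectrum (cmat A) \<subseteq> {z. Re z \<le> 0}"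
proof
  fix z assume "z \<in> spectrum (cmat A)"
  then obtain v where "eigenvector (cmat A) v z"
    unfolding spectrum_def eigenvalue_def by blast
  then have v: "v \<in> carrier_vec n" "v \<noteq> 0\<^sub>v n" and ev: "cmat A *\<^sub>v v = z \<cdot>\<^sub>v v"
    using dH_carrier(4) unfolding eigenvector_def by auto
  define q where "q = real_inner v (cmat Q *\<^sub>v v)"
  have "Re z * q = real_inner (cmat Q *\<^sub>v v) (cmat A *\<^sub>v v)"
    unfolding ev q_def using real_inner_sym_imag_unit[OF dH_carrier(3) dH_transpose(3) v(1)] v(1)
      real_inner_commute[of v n "cmat Q *\<^sub>v v"]
    by (subst real_inner_smult_right) simp
  also have "\<dots> \<le> 0"
    using dH_real_inner_self[OF v(1)] sym_pos_semidef_real_inner(1)[OF dH_psd(1), of "cmat Q *\<^sub>v v"] v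
    by simp
  finally have le: "Re z * q \<le> 0" .
  have "0 \<le> q" unfolding q_def by (rule sym_pos_semidef_real_inner(1)[OF dH_psd(2) v(1)])
  moreover have "z = 0" if "q = 0"
  proof -
    have "cmat Q *\<^sub>v v = 0\<^sub>v n"
      using sym_pos_semidef_real_inner(2)[OF dH_psd(2) v(1)] that by (simp add: q_def)
    then have z0: "z \<cdot>\<^sub>v v = 0\<^sub>v n" using dH_A_Q_kernel[OF v(1)] unfolding ev by blast
    obtain i where i: "i < n" "v $ i \<noteq> 0" using v by (auto simp: vec_eq_iff)
    have "z * v $ i = 0" using arg_cong[OF z0, of "\<lambda>u. u $ i"] i(1) v(1) by simp
    with i show ?thesis by simp
  qed
  ultimately show "z \<in> {z. Re z \<le> 0}"
    using le by (cases "q = 0") (auto simp: mult_le_0_iff)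
qed

lemma dH_shift_kernel:
  assumes v: "v \<in> carrier_vec n"
  shows "cmat A *\<^sub>v v = (\<i> * complex_of_real \<alpha>) \<cdot>\<^sub>v v \<longleftrightarrow>
    cmat J *\<^sub>v (cmat Q *\<^sub>v v) = (\<i> * complex_of_real \<alpha>) \<cdot>\<^sub>v v \<and>
    cmat R *\<^sub>v (cmat Q *\<^sub>v v) = 0\<^sub>v n"
proof
  assume "cmat J *\<^sub>v (cmat Q *\<^sub>v v) = (\<i> * complex_of_real \<alpha>) \<cdot>\<^sub>v v \<and>
    cmat R *\<^sub>v (cmat Q *\<^sub>v v) = 0\<^sub>v n"
  then show "cmat A *\<^sub>v v = (\<i> * complex_of_real \<alpha>) \<cdot>\<^sub>v v"
    using v by (simp add: dH_mult_vec)
qed (use v dH_imaginary_eigenvector in auto)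

text \<open>The chain argument gives \<open>Q w = 0\<close>, hence \<open>A w = 0\<close>; a vector
  with the nonzero eigenvalue i \<alpha> in ker A must vanish.\<close>

lemma dH_shift_semisimple:
  assumes v: "v \<in> carrier_vec n" and "\<alpha> \<noteq> 0"
    and w: "w = cmat A *\<^sub>v v - (\<i> * complex_of_real \<alpha>) \<cdot>\<^sub>v v"
    and ev: "cmat A *\<^sub>v w = (\<i> * complex_of_real \<alpha>) \<cdot>\<^sub>v w"
  shows "w = 0\<^sub>v n"
proof -
  have wc: "w \<in> carrier_vec n" using v by (auto simp: w)
  have "(\<i> * complex_of_real \<alpha>) \<cdot>\<^sub>v w = 0\<^sub>v n"
    using dH_A_Q_kernel[OF wc dH_imaginary_chain[OF v w ev]] ev by simp
  with wc \<open>\<alpha> \<noteq> 0\<close> show ?thesis by (auto simp: vec_eq_iff)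
qed

end

section \<open>Kernels of shifted matrices and the kernel identities\<close>

lemma shift_mat_carrier: "M \<in> carrier_mat n n \<Longrightarrow> shift_mat n M \<alpha> \<in> carrier_mat n n"
  unfolding shift_mat_def by (intro minus_carrier_mat smult_carrier_mat one_carrier_mat)

lemma shift_mat_mult_vec:
  assumes "M \<in> carrier_mat n n" "v \<in> carrier_vec n"
  shows "shift_mat n M \<alpha> *\<^sub>v v = cmat M *\<^sub>v v - (\<i> * complex_of_real \<alpha>) \<cdot>\<^sub>v v"
proof -
  have "(z \<cdot>\<^sub>m 1\<^sub>m n) *\<^sub>v v = z \<cdot>\<^sub>v v" for z :: complex
    using assms(2) by (intro eq_vecI) auto
  then show ?thesis
    unfolding shift_mat_def using assms by (subst minus_mult_distrib_mat_vec[of _ n n]) auto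
qed

lemma minus_vec_eq_0_iff:
  "v \<in> carrier_vec n \<Longrightarrow> w \<in> carrier_vec n \<Longrightarrow> v - w = 0\<^sub>v n \<longleftrightarrow> v = (w :: complex vec)"
  by (auto simp: vec_eq_iff)

lemma shift_mat_kernel:
  assumes M: "M \<in> carrier_mat n n"
  shows "mat_kernel (shift_mat n M \<alpha>) =
    {v \<in> carrier_vec n. cmat M *\<^sub>v v = (\<i> * complex_of_real \<alpha>) \<cdot>\<^sub>v v}"
proof -
  have "cmat M *\<^sub>v v \<in> carrier_vec n" if "v \<in> carrier_vec n" for v using M that by auto
  then show ?thesis
    using M by (auto simp: mat_kernel[OF shift_mat_carrier[OF M]] shift_mat_mult_vec
        minus_vec_eq_0_iff[of _ n])
qed

lemma pow_mat_two: "M \<in> carrier_mat n n \<Longrightarrow> M ^\<^sub>m 2 = M * (M :: 'a :: comm_ring_1 mat)"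
  by (simp add: numeral_2_eq_2)

lemma pow_mat_three: "M \<in> carrier_mat n n \<Longrightarrow> M ^\<^sub>m 3 = M * (M * (M :: 'a :: comm_ring_1 mat))"
  by (simp add: numeral_3_eq_3 assoc_mult_mat[of _ n n _ n _ n])

text \<open>The condition is phrased as (M - i \<alpha>) v lying in the eigenspace, the shape in
  which the chain lemmas take their hypotheses.\<close>

lemma shift_mat_sq_kernel:
  assumes M: "M \<in> carrier_mat n n"
  shows "mat_kernel (shift_mat n M \<alpha> ^\<^sub>m 2) =
    {v \<in> carrier_vec n. cmat M *\<^sub>v (cmat M *\<^sub>v v - (\<i> * complex_of_real \<alpha>) \<cdot>\<^sub>v v) =
      (\<i> * complex_of_real \<alpha>) \<cdot>\<^sub>v (cmat M *\<^sub>v v - (\<i> * complex_of_real \<alpha>) \<cdot>\<^sub>v v)}"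
proof -
  let ?S = "shift_mat n M \<alpha>"
  have S: "?S \<in> carrier_mat n n" by (rule shift_mat_carrier[OF M])
  have "mat_kernel (?S ^\<^sub>m 2) = {v \<in> carrier_vec n. ?S *\<^sub>v v \<in> mat_kernel ?S}"
    using S by (auto simp: mat_kernel[of _ n n] pow_mat_two assoc_mult_mat_vec[of _ n n _ n])
  moreover have "cmat M *\<^sub>v v - (\<i> * complex_of_real \<alpha>) \<cdot>\<^sub>v v \<in> carrier_vec n"
    if "v \<in> carrier_vec n" for v
    using that M by (intro minus_carrier_vec mult_mat_vec_carrier[of _ n n]) auto
  ultimately show ?thesis
    unfolding shift_mat_kernel[OF M] using shift_mat_mult_vec[OF M] by auto
qed

text \<open>The energy lemmas speak of complex vectors, the kernels of \<open>A\<close> and its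
  powers of real ones; this restricts the former to embedded real vectors.\<close>

lemma real_kernel_iff:
  assumes "M \<in> carrier_mat n n" "x \<in> carrier_vec n"
  shows "M *\<^sub>v x = 0\<^sub>v n \<longleftrightarrow> cmat M *\<^sub>v cvec x = 0\<^sub>v n"
  using assms cmat_mult_cvec[OF assms] cvec_eq_0_iff by simp

theorem dH_kernels:
  assumes dH: "dH_decomposition n A J R Q"
  shows "\<alpha> \<noteq> 0 \<Longrightarrow> mat_kernel (shift_mat n A \<alpha> ^\<^sub>m 2) = mat_kernel (shift_mat n A \<alpha>)"
    and "mat_kernel (shift_mat n A \<alpha>) =
      mat_kernel (shift_mat n (J * Q) \<alpha>) \<inter> mat_kernel (cmat (R * Q))"
    and "mat_kernel A = mat_kernel (J * Q) \<inter> mat_kernel (R * Q)"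
    and "mat_kernel (A ^\<^sub>m 3) = mat_kernel (A ^\<^sub>m 2)"
    and "mat_kernel (A ^\<^sub>m 2) = mat_kernel (Q * J * Q) \<inter> mat_kernel (R * Q)"
proof -
  note C = dH_carrier[OF dH] and cC = dH_cmat_carrier[OF dH]
  have JQ: "J * Q \<in> carrier_mat n n" and RQ: "R * Q \<in> carrier_mat n n"
    and QJQ: "Q * J * Q \<in> carrier_mat n n" and AA: "A * A \<in> carrier_mat n n"
    and AAA: "A * (A * A) \<in> carrier_mat n n" using C by auto
  have app: "cmat (M * N) *\<^sub>v v = cmat M *\<^sub>v (cmat N *\<^sub>v v)"
    if "M \<in> carrier_mat n n" "N \<in> carrier_mat n n" "v \<in> carrier_vec n" for M N v
    using that by (simp add: cmat_mult[of M n n N n] assoc_mult_mat_vec[of _ n n _ n])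
  note QJQ_app = app[OF mult_carrier_mat[OF C(3,1)] C(3)] app[OF C(3,1)]
  note kernels = mat_kernel[OF C(4)] mat_kernel[OF JQ] mat_kernel[OF RQ] mat_kernel[OF QJQ]
    mat_kernel[OF AA] mat_kernel[OF AAA]
  show "mat_kernel (shift_mat n A \<alpha> ^\<^sub>m 2) = mat_kernel (shift_mat n A \<alpha>)" if "\<alpha> \<noteq> 0"
    unfolding shift_mat_kernel[OF C(4)] shift_mat_sq_kernel[OF C(4)]
  proof (intro Collect_cong conj_cong refl iffI)
    fix v :: "complex vec" assume v: "v \<in> carrier_vec n"
    let ?z = "\<i> * complex_of_real \<alpha>"
    have c: "cmat A *\<^sub>v v \<in> carrier_vec n" "?z \<cdot>\<^sub>v v \<in> carrier_vec n"
      using v dH_mult_carrier[OF dH] by auto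
    { assume "cmat A *\<^sub>v (cmat A *\<^sub>v v - ?z \<cdot>\<^sub>v v) = ?z \<cdot>\<^sub>v (cmat A *\<^sub>v v - ?z \<cdot>\<^sub>v v)"
      from dH_shift_semisimple[OF dH v that refl this]
      show "cmat A *\<^sub>v v = ?z \<cdot>\<^sub>v v" using minus_vec_eq_0_iff[OF c] by simp }
    { assume "cmat A *\<^sub>v v = ?z \<cdot>\<^sub>v v"
      then have "cmat A *\<^sub>v v - ?z \<cdot>\<^sub>v v = 0\<^sub>v n" using minus_vec_eq_0_iff[OF c] by simp
      then show "cmat A *\<^sub>v (cmat A *\<^sub>v v - ?z \<cdot>\<^sub>v v) = ?z \<cdot>\<^sub>v (cmat A *\<^sub>v v - ?z \<cdot>\<^sub>v v)"
        by (auto simp: dH_mult_zero[OF dH] intro!: eq_vecI) }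
  qed
  have RQ': "cmat (R * Q) \<in> carrier_mat n n" using RQ by simp
  show "mat_kernel (shift_mat n A \<alpha>) =
      mat_kernel (shift_mat n (J * Q) \<alpha>) \<inter> mat_kernel (cmat (R * Q))"
    unfolding shift_mat_kernel[OF C(4)] shift_mat_kernel[OF JQ] mat_kernel[OF RQ']
    using dH_shift_kernel[OF dH] app[OF C(1,3)] app[OF C(2,3)] by auto
  \<comment> \<open>This is the shifted identity at \<open>\<alpha> = 0\<close>, where the multiple
    of \<open>v\<close> becomes the zero vector.\<close>
  show "mat_kernel A = mat_kernel (J * Q) \<inter> mat_kernel (R * Q)"
    unfolding kernels
    using dH_shift_kernel[OF dH, of _ 0] app[OF C(1,3)] app[OF C(2,3)]
      real_kernel_iff[OF C(4)] real_kernel_iff[OF JQ] real_kernel_iff[OF RQ]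
    by (auto simp: zero_smult_vec[of _ n])
  show "mat_kernel (A ^\<^sub>m 3) = mat_kernel (A ^\<^sub>m 2)"
    unfolding pow_mat_two[OF C(4)] pow_mat_three[OF C(4)] kernels
    using dH_AAA_kernel[OF dH] app[OF C(4) AA] app[OF C(4,4)] real_kernel_iff[OF AA] real_kernel_iff[OF AAA]
    by auto
  show "mat_kernel (A ^\<^sub>m 2) = mat_kernel (Q * J * Q) \<inter> mat_kernel (R * Q)"
    unfolding pow_mat_two[OF C(4)] kernels
    using dH_AA_kernel[OF dH] dH_QA_kernel[OF dH] app[OF C(4,4)] QJQ_app app[OF C(2,3)]
      dH_mult_carrier[OF dH] real_kernel_iff[OF AA] real_kernel_iff[OF RQ] real_kernel_iff[OF QJQ]
    by auto
qed

section \<open>Generalized inverses\<close>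

text \<open>Let \<open>G\<close> send the i-th unit vector to the unit vector at the pivot column of
  row \<open>i\<close>. Pivot columns of \<open>W\<close> are unit vectors, so \<open>W G\<close> is
  the diagonal projector onto the nonzero rows, and it fixes \<open>W\<close>.\<close>

lemma row_echelon_form_generalized_inverse:
  fixes W :: "'a :: field mat"
  assumes W: "W \<in> carrier_mat n n" and ref: "row_echelon_form W"
  obtains G where "G \<in> carrier_mat n n" "W * G * W = W"
proof -
  from ref W obtain f where "pivot_fun W f n" unfolding row_echelon_form_def by auto
  note f = pivot_funD[OF carrier_matD(1)[OF W] this]
  \<comment> \<open>The value \<open>f i = n\<close> marks a zero row; no \<open>j < n\<close>
    matches it, so column \<open>i\<close> of \<open>G\<close> is zero.\<close>
  define G where "G = mat n n (\<lambda>(j, i). if f i = j then 1 else (0 :: 'a))"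
  have G: "G \<in> carrier_mat n n" by (simp add: G_def)
  have WG: "(W * G) $$ (k, i) = (if f i < n \<and> k = i then 1 else 0)" if "k < n" "i < n" for k i
  proof -
    have "(W * G) $$ (k, i) = (\<Sum>j = 0..<n. W $$ (k, j) * (if f i = j then 1 else 0))"
      using that W G by (auto simp: scalar_prod_def G_def)
    also have "\<dots> = (\<Sum>j = 0..<n. if f i = j then W $$ (k, j) else 0)"
      by (intro sum.cong) auto
    also have "\<dots> = (if f i < n then W $$ (k, f i) else 0)" by (simp add: sum.delta)
    also have "\<dots> = (if f i < n \<and> k = i then 1 else 0)" using f(4,5) that by auto
    finally show ?thesis .
  qed
  have prod_entry: "(X * W) $$ (k, l) = (\<Sum>i = 0..<n. X $$ (k, i) * W $$ (i, l))"
    if "X \<in> carrier_mat n n" "k < n" "l < n" for X k l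
    using that W by (auto simp: scalar_prod_def)
  have "W * G * W = W"
  proof (rule eq_matI)
    fix k l assume "k < dim_row W" "l < dim_col W"
    then have kl: "k < n" "l < n" using W by auto
    have "(W * G * W) $$ (k, l) = (\<Sum>i = 0..<n. (W * G) $$ (k, i) * W $$ (i, l))"
      using prod_entry[OF mult_carrier_mat[OF W G] kl] .
    also have "\<dots> = (\<Sum>i = 0..<n. if k = i then (if f k < n then W $$ (k, l) else 0) else 0)"
      using kl by (intro sum.cong) (auto simp: WG)
    also have "\<dots> = (if f k < n then W $$ (k, l) else 0)" using kl by (simp add: sum.delta')
    also have "\<dots> = W $$ (k, l)" using f(1,2)[OF kl(1)] kl(2) by (auto simp: not_less)
    finally show "(W * G * W) $$ (k, l) = W $$ (k, l)" .
  qed (use W in auto)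
  with G that show thesis by blast
qed

text \<open>With \<open>W = E Q\<close> and \<open>Q = F W\<close>, a generalized inverse
  \<open>G\<close> of \<open>W\<close> yields \<open>G E\<close> for \<open>Q\<close>: Q G E Q = F W
  G W = F W.\<close>

lemma generalized_inverse:
  fixes Q :: "'a :: field mat"
  assumes Q: "Q \<in> carrier_mat n n"
  obtains G where "G \<in> carrier_mat n n" "Q * G * Q = Q"
proof -
  define W where "W = gauss_jordan_single Q"
  note gj = gauss_jordan_single[OF Q W_def[symmetric]]
  from gj(4) obtain E F where E: "W = E * Q" "E \<in> carrier_mat n n" "F \<in> carrier_mat n n"
    "F * E = 1\<^sub>m n" by blast
  from row_echelon_form_generalized_inverse[OF gj(2,3)]
  obtain G where G: "G \<in> carrier_mat n n" "W * G * W = W" .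
  have FW: "F * W = Q"
    using E(2-4) Q unfolding E(1) by (simp add: assoc_mult_mat[of F n n E n Q n, symmetric])
  have "Q * (G * E) * Q = F * (W * G * W)"
  proof -
    have "Q * (G * E) * Q = Q * (G * (E * Q))"
      using Q G(1) E by (simp add: assoc_mult_mat[of _ n n _ n _ n])
    also have "\<dots> = F * W * (G * W)" using FW E(1) by simp
    also have "\<dots> = F * (W * G * W)"
      using gj(2) E(3) G(1) by (simp add: assoc_mult_mat[of _ n n _ n _ n])
    finally show ?thesis .
  qed
  then have "Q * (G * E) * Q = Q" using G(2) FW by simp
  moreover have "G * E \<in> carrier_mat n n" using G(1) E(2) by simp
  ultimately show thesis using that by blast
qed

text \<open>Transposing Q H Q = Q shows that the transpose of \<open>H\<close> is a generalized
  inverse too; the condition is affine in \<open>H\<close>, so the average of both works.\<close>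

lemma symmetric_generalized_inverse:
  fixes Q :: "real mat"
  assumes Q: "Q \<in> carrier_mat n n" "Q\<^sup>T = Q"
  obtains G where "G \<in> carrier_mat n n" "G\<^sup>T = G" "Q * G * Q = Q"
proof -
  obtain H where H: "H \<in> carrier_mat n n" "Q * H * Q = Q" using generalized_inverse[OF Q(1)] .
  have HT: "Q * H\<^sup>T * Q = Q"
  proof -
    have "(Q * H * Q)\<^sup>T = Q * (H\<^sup>T * Q)"
      using Q H(1) by (simp add: transpose_mult[of _ n n _ n])
    then show ?thesis using H Q by (simp add: assoc_mult_mat[of Q n n "H\<^sup>T" n Q n])
  qed
  define G where "G = (1/2) \<cdot>\<^sub>m (H + H\<^sup>T)"
  have G: "G \<in> carrier_mat n n" using H(1) by (simp add: G_def)
  have "G\<^sup>T = G" using H(1) by (intro eq_matI) (auto simp: G_def)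
  moreover have "Q * G * Q = Q"
  proof -
    have "Q * G * Q = (1/2) \<cdot>\<^sub>m (Q * (H + H\<^sup>T) * Q)"
      using Q(1) H(1)
      by (simp add: G_def mult_smult_distrib[of _ n n _ n] mult_smult_assoc_mat[of _ n n _ n])
    also have "Q * (H + H\<^sup>T) * Q = Q * H * Q + Q * H\<^sup>T * Q"
      using Q(1) H(1)
      by (simp add: mult_add_distrib_mat[of _ n n _ n] add_mult_distrib_mat[of _ n n _ _ n])
    also have "(1/2) \<cdot>\<^sub>m \<dots> = Q" unfolding H(2) HT by (intro eq_matI) auto
    finally show ?thesis .
  qed
  ultimately show thesis using that G by blast
qed

section \<open>From a dissipative form to a decomposition\<close>

lemma mat_eq_vecI:
  fixes M N :: "'a :: comm_ring_1 mat"
  assumes M: "M \<in> carrier_mat m n" and N: "N \<in> carrier_mat m n"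
    and eq: "\<And>x. x \<in> carrier_vec n \<Longrightarrow> M *\<^sub>v x = N *\<^sub>v x"
  shows "M = N"
proof (rule mat_col_eqI)
  fix i assume "i < dim_col N"
  then have i: "i < n" using N by simp
  have "X *\<^sub>v unit_vec n i = col X i" if "X \<in> carrier_mat m n" for X :: "'a mat"
    using that i by (intro eq_vecI) auto
  then show "col M i = col N i"
    using eq[OF unit_vec_carrier[of n i]] M N by simp
qed (use M N in auto)

text \<open>With a symmetric generalized inverse \<open>G\<close> of \<open>Q\<close>, the matrix
  \<open>M = A G - G A\<^sup>T (1 - Q G)\<close> satisfies \<open>M Q = A G Q = A\<close>, and its quadratic form at \<open>x\<close> is that of
  \<open>Q A\<close> at \<open>G x\<close>; so \<open>J\<close> and \<open>- R\<close> can be taken as its skew and symmetric parts, respectively.\<close>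

lemma dissipative_HamiltonianI:
  assumes A: "A \<in> carrier_mat n n" and psd: "sym_pos_semidef n Q"
    and ker: "\<And>x. x \<in> carrier_vec n \<Longrightarrow> Q *\<^sub>v x = 0\<^sub>v n \<Longrightarrow> A *\<^sub>v x = 0\<^sub>v n"
    and diss: "\<And>x. x \<in> carrier_vec n \<Longrightarrow> (Q *\<^sub>v x) \<bullet> (A *\<^sub>v x) \<le> 0"
  shows "dissipative_Hamiltonian n A"
proof -
  note Q = sym_pos_semidefD[OF psd]
  obtain G where G: "G \<in> carrier_mat n n" "G\<^sup>T = G" "Q * G * Q = Q"
    using symmetric_generalized_inverse[OF Q(1,2)] .
  have AT: "A\<^sup>T \<in> carrier_mat n n" using A by simp
  \<comment> \<open>\<open>A G\<close> alone would give back \<open>A\<close> after multiplication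
    by \<open>Q\<close>, but its form pairs \<open>x\<close> with \<open>A G x\<close>. The two
    correction terms cancel against each other on the range of \<open>Q\<close>, and in the form
    they replace \<open>x\<close> by \<open>Q G x\<close>.\<close>
  define M where "M = A * G - G * A\<^sup>T + G * A\<^sup>T * Q * G"
  have GAQG: "G * A\<^sup>T * Q * G \<in> carrier_mat n n"
    using AT G(1) Q(1) by (intro mult_carrier_mat)
  then have M: "M \<in> carrier_mat n n" unfolding M_def by (rule add_carrier_mat)
  have M_app: "M *\<^sub>v x = A *\<^sub>v (G *\<^sub>v x) - G *\<^sub>v (A\<^sup>T *\<^sub>v x) + G *\<^sub>v (A\<^sup>T *\<^sub>v (Q *\<^sub>v (G *\<^sub>v x)))"
    if x: "x \<in> carrier_vec n" for x
  proof -
    have "M *\<^sub>v x = (A * G) *\<^sub>v x - (G * A\<^sup>T) *\<^sub>v x + (G * A\<^sup>T * Q * G) *\<^sub>v x"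
      unfolding M_def
      using add_mult_distrib_mat_vec[OF minus_carrier_mat[OF mult_carrier_mat[OF G(1) AT]] GAQG x]
        minus_mult_distrib_mat_vec[OF mult_carrier_mat[OF A G(1)] mult_carrier_mat[OF G(1) AT] x]
      by simp
    then show ?thesis
      using A G Q x AT by (simp add: assoc_mult_mat_vec[of _ n n _ n])
  qed
  have MQ: "M * Q = A"
  proof (rule mat_eq_vecI)
    fix x :: "real vec" assume x: "x \<in> carrier_vec n"
    have Qx: "Q *\<^sub>v x \<in> carrier_vec n" and GQx: "G *\<^sub>v (Q *\<^sub>v x) \<in> carrier_vec n"
      using Q(1) G(1) x by auto
    have QGQ: "Q *\<^sub>v (G *\<^sub>v (Q *\<^sub>v x)) = Q *\<^sub>v x"
    proof -
      have "Q *\<^sub>v (G *\<^sub>v (Q *\<^sub>v x)) = (Q * G * Q) *\<^sub>v x"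
        using Q(1) G(1) x by (simp add: assoc_mult_mat_vec[of _ n n _ n])
      then show ?thesis unfolding G(3) .
    qed
    \<comment> \<open>Modulo ker Q, \<open>G Q\<close> acts as the identity; as ker Q lies in ker A,
      this gives A G Q x = A x.\<close>
    have "Q *\<^sub>v (x - G *\<^sub>v (Q *\<^sub>v x)) = 0\<^sub>v n"
      using mult_minus_distrib_mat_vec[OF Q(1) x GQx] QGQ Qx by simp
    then have "A *\<^sub>v (x - G *\<^sub>v (Q *\<^sub>v x)) = 0\<^sub>v n" using ker x GQx by simp
    then have AGQ: "A *\<^sub>v x - A *\<^sub>v (G *\<^sub>v (Q *\<^sub>v x)) = 0\<^sub>v n"
      using mult_minus_distrib_mat_vec[OF A x GQx] by simp
    have c: "A *\<^sub>v x \<in> carrier_vec n" "A *\<^sub>v (G *\<^sub>v (Q *\<^sub>v x)) \<in> carrier_vec n"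
      "G *\<^sub>v (A\<^sup>T *\<^sub>v (Q *\<^sub>v x)) \<in> carrier_vec n"
      using A AT G(1) x Qx GQx by auto
    have minus_add: "u - w + w = u" if "u \<in> carrier_vec n" "w \<in> carrier_vec n" for u w :: "real vec"
      using that by (intro eq_vecI) auto
    have "(M * Q) *\<^sub>v x = M *\<^sub>v (Q *\<^sub>v x)" using M Q(1) x by simp
    also have "\<dots> = A *\<^sub>v (G *\<^sub>v (Q *\<^sub>v x))"
      using M_app[OF Qx] QGQ minus_add[OF c(2,3)] by simp
    also have "\<dots> = A *\<^sub>v x" using minus_add[OF c(1,2)] AGQ c by simp
    finally show "(M * Q) *\<^sub>v x = A *\<^sub>v x" .
  qed (use M Q A in auto)
  have M_form: "x \<bullet> (M *\<^sub>v x) \<le> 0" if x: "x \<in> carrier_vec n" for x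
  proof -
    define y where "y = G *\<^sub>v x"
    have y: "y \<in> carrier_vec n" using G x by (auto simp: y_def)
    have c: "A *\<^sub>v y \<in> carrier_vec n" "Q *\<^sub>v y \<in> carrier_vec n" "A\<^sup>T *\<^sub>v x \<in> carrier_vec n"
      "A\<^sup>T *\<^sub>v (Q *\<^sub>v y) \<in> carrier_vec n"
      using A AT Q(1) x y by auto
    \<comment> \<open>With \<open>z = x\<close> this cancels the first term of the form of
      \<open>M\<close>; with \<open>z = Q y\<close> it produces the dissipative form at
      \<open>y\<close>.\<close>
    have GAT: "x \<bullet> (G *\<^sub>v (A\<^sup>T *\<^sub>v z)) = z \<bullet> (A *\<^sub>v y)" if z: "z \<in> carrier_vec n" for z
    proof -
      have ATz: "A\<^sup>T *\<^sub>v z \<in> carrier_vec n" using AT z by auto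
      have "x \<bullet> (G *\<^sub>v (A\<^sup>T *\<^sub>v z)) = y \<bullet> (A\<^sup>T *\<^sub>v z)"
        using transpose_vec_mult_scalar[OF G(1) ATz x] by (simp add: G(2) y_def)
      also have "\<dots> = (A\<^sup>T *\<^sub>v z) \<bullet> y" using comm_scalar_prod[OF y ATz] .
      also have "\<dots> = z \<bullet> (A *\<^sub>v y)" using transpose_vec_mult_scalar[OF A y z] .
      finally show ?thesis .
    qed
    have "x \<bullet> (M *\<^sub>v x) = x \<bullet> (A *\<^sub>v y) - x \<bullet> (G *\<^sub>v (A\<^sup>T *\<^sub>v x))
        + x \<bullet> (G *\<^sub>v (A\<^sup>T *\<^sub>v (Q *\<^sub>v y)))"
      unfolding M_app[OF x] y_def[symmetric] using x c G(1)
      by (simp add: scalar_prod_add_distrib[of _ n] scalar_prod_minus_distrib[of _ n])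
    also have "\<dots> = (Q *\<^sub>v y) \<bullet> (A *\<^sub>v y)" using GAT[OF x] GAT[OF c(2)] by simp
    also have "\<dots> \<le> 0" using diss[OF y] .
    finally show ?thesis .
  qed
  define J where "J = (1/2) \<cdot>\<^sub>m (M - M\<^sup>T)"
  define R where "R = (- 1/2) \<cdot>\<^sub>m (M + M\<^sup>T)"
  have J: "J \<in> carrier_mat n n" and R: "R \<in> carrier_mat n n" using M by (auto simp: J_def R_def)
  have "J\<^sup>T = - J" using M by (intro eq_matI) (auto simp: J_def field_simps)
  moreover have "R\<^sup>T = R" using M by (intro eq_matI) (auto simp: R_def)
  moreover have "J - R = M" using M by (intro eq_matI) (auto simp: J_def R_def field_simps)
  moreover have "0 \<le> x \<bullet> (R *\<^sub>v x)" if x: "x \<in> carrier_vec n" for x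
  proof -
    have c: "M *\<^sub>v x \<in> carrier_vec n" "M\<^sup>T *\<^sub>v x \<in> carrier_vec n" using M x by auto
    have smult_app: "(k \<cdot>\<^sub>m X) *\<^sub>v x = k \<cdot>\<^sub>v (X *\<^sub>v x)" if "X \<in> carrier_mat n n" for X and k :: real
      using that x by (intro eq_vecI) (auto simp: scalar_prod_def sum_distrib_left mult.assoc)
    have "R *\<^sub>v x = (- 1/2) \<cdot>\<^sub>v (M *\<^sub>v x + M\<^sup>T *\<^sub>v x)"
      using smult_app[of "M + M\<^sup>T" "- 1/2"] add_mult_distrib_mat_vec[of M n n "M\<^sup>T" x] M x
      by (simp add: R_def)
    then have "x \<bullet> (R *\<^sub>v x) = (- 1/2) * (x \<bullet> (M *\<^sub>v x) + x \<bullet> (M\<^sup>T *\<^sub>v x))"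
      using x c by (simp add: scalar_prod_add_distrib[of _ n])
    also have "x \<bullet> (M\<^sup>T *\<^sub>v x) = x \<bullet> (M *\<^sub>v x)"
      using transpose_vec_mult_scalar[OF M x x] comm_scalar_prod[OF x c(2)] by simp
    finally show ?thesis using M_form[OF x] by simp
  qed
  ultimately have "dH_decomposition n A J R Q"
    using J R psd MQ
    unfolding dH_decomposition_def sym_pos_semidef_def skew_symmetric_mat_def symmetric_mat_def by auto
  then show ?thesis unfolding dissipative_Hamiltonian_def by blast
qed

section \<open>Complex Jordan chains under the kernel conditions\<close>

text \<open>This trades block sizes for entries: later arguments only ask where the superdiagonal is
  1 and that the eigenvalue is constant across such a link.\<close>

lemma jordan_matrix_bidiagonal:
  assumes "i < sum_list (map fst n_as)" "j < sum_list (map fst n_as)"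
  shows "i \<noteq> j \<Longrightarrow> Suc i \<noteq> j \<Longrightarrow> jordan_matrix n_as $$ (i, j) = (0 :: complex)"
    and "Suc i = j \<Longrightarrow> jordan_matrix n_as $$ (i, j) = 0 \<or>
      jordan_matrix n_as $$ (i, j) = 1 \<and> jordan_matrix n_as $$ (i, i) = jordan_matrix n_as $$ (j, j)"
  using assms
proof (induction n_as arbitrary: i j)
  case (Cons na n_as)
  obtain m a where na: "na = (m, a)" by force
  {
    case 1
    then show ?case
      using Cons.IH(1)[of "i - m" "j - m"] unfolding na jordan_matrix_Cons
      by (auto simp: jordan_block_def)
  next
    case 2
    then show ?case
      using Cons.IH(2)[of "i - m" "j - m"] unfolding na jordan_matrix_Cons
      by (auto simp: jordan_block_def Suc_diff_le)
  }
qed auto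

text \<open>\<open>S k\<close> says that \<open>k\<close> and \<open>k + 1\<close> belong to the same Jordan block.\<close>

lemma jordan_chain_basis:
  fixes A :: "complex mat"
  assumes A: "A \<in> carrier_mat n n"
  obtains lam :: "nat \<Rightarrow> complex" and S :: "nat \<Rightarrow> bool" and C P
  where "C \<in> carrier_mat n n" "P \<in> carrier_mat n n" "P * C = 1\<^sub>m n" "C * P = 1\<^sub>m n"
    and "\<And>k. S k \<Longrightarrow> Suc k < n \<and> lam (Suc k) = lam k"
    and "\<And>x k. x \<in> carrier_vec n \<Longrightarrow> k < n \<Longrightarrow>
      (C *\<^sub>v (A *\<^sub>v x)) $ k = lam k * (C *\<^sub>v x) $ k + (if S k then (C *\<^sub>v x) $ Suc k else 0)"
proof -
  obtain as where "char_poly A = (\<Prod>a\<leftarrow>as. [:- a, 1:])"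
    using char_poly_factorized[OF A] by blast
  from jordan_nf_exists[OF A this] obtain n_as where "jordan_nf A n_as" ..
  then have "similar_mat A (jordan_matrix n_as)" unfolding jordan_nf_def by auto
  then obtain P C where wit: "similar_mat_wit A (jordan_matrix n_as) P C"
    unfolding similar_mat_def by blast
  define B where "B = jordan_matrix n_as"
  from similar_mat_witD[OF carrier_matD(1)[OF A, symmetric] wit]
  have PC: "P * C = 1\<^sub>m n" "C * P = 1\<^sub>m n" and APC: "A = P * B * C"
    and B: "B \<in> carrier_mat n n" and P: "P \<in> carrier_mat n n" and C: "C \<in> carrier_mat n n"
    unfolding B_def by auto
  have N: "sum_list (map fst n_as) = n" using B unfolding B_def by auto
  define lam where "lam k = B $$ (k, k)" for k
  define S where "S k \<longleftrightarrow> Suc k < n \<and> B $$ (k, Suc k) = 1" for k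
  have S: "Suc k < n \<and> lam (Suc k) = lam k" if "S k" for k
    using that jordan_matrix_bidiagonal(2)[of k n_as "Suc k"] N
    unfolding S_def lam_def B_def by auto
  have "(C *\<^sub>v (A *\<^sub>v x)) $ k = lam k * (C *\<^sub>v x) $ k + (if S k then (C *\<^sub>v x) $ Suc k else 0)"
    if x: "x \<in> carrier_vec n" and k: "k < n" for x k
  proof -
    define y where "y = C *\<^sub>v x"
    have y: "y \<in> carrier_vec n" using C x by (auto simp: y_def)
    have "C * (P * (B * C)) = B * C"
      using PC P B C by (simp add: assoc_mult_mat[of C n n P n "B * C" n, symmetric])
    then have "C * A = B * C" using P B C unfolding APC by simp
    then have "C *\<^sub>v (A *\<^sub>v x) = B *\<^sub>v y"
      using A B C x unfolding y_def by (metis assoc_mult_mat_vec)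
    then have "(C *\<^sub>v (A *\<^sub>v x)) $ k = (\<Sum>j = 0..<n. B $$ (k, j) * y $ j)"
      using B y k by (auto simp: scalar_prod_def)
    also have "\<dots> = (\<Sum>j = 0..<n. (if j = k then lam k * y $ k else 0)
        + (if j = Suc k then (if S k then y $ Suc k else 0) else 0))"
      using jordan_matrix_bidiagonal[of k n_as] k N
      by (intro sum.cong) (auto simp: lam_def S_def B_def)
    also have "\<dots> = lam k * y $ k + (if S k then y $ Suc k else 0)"
      using k S by (auto simp: sum.distrib sum.delta)
    finally show ?thesis by (simp add: y_def)
  qed
  with C P PC S show thesis by (rule that)
qed

text \<open>Dual view of the coordinate action: since coordinate \<open>k - 1\<close> reads
  coordinate \<open>k\<close> across a link, \<open>A\<close> sends basis vector \<open>k\<close> to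
  its eigenvalue multiple plus basis vector \<open>k - 1\<close>. Both sides are compared after
  applying the invertible \<open>C\<close>.\<close>

lemma jordan_chain_basis_column:
  fixes A :: "complex mat"
  assumes A: "A \<in> carrier_mat n n" and C: "C \<in> carrier_mat n n" and P: "P \<in> carrier_mat n n"
    and PC: "P * C = 1\<^sub>m n" "C * P = 1\<^sub>m n"
    and act: "\<And>x k. x \<in> carrier_vec n \<Longrightarrow> k < n \<Longrightarrow>
      (C *\<^sub>v (A *\<^sub>v x)) $ k = lam k * (C *\<^sub>v x) $ k + (if S k then (C *\<^sub>v x) $ Suc k else 0)"
    and S: "\<And>k. S k \<Longrightarrow> Suc k < n"
    and k: "k < n"
  shows "A *\<^sub>v col P k = lam k \<cdot>\<^sub>v col P k + (if 0 < k \<and> S (k - 1) then col P (k - 1) else 0\<^sub>v n)"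
    and "col P k \<noteq> 0\<^sub>v n"
proof -
  \<comment> \<open>The guard \<open>0 < k\<close> matters because \<open>0 - 1 = 0\<close>: a link
    at 0 would otherwise add the first vector to itself.\<close>
  let ?r = "lam k \<cdot>\<^sub>v col P k + (if 0 < k \<and> S (k - 1) then col P (k - 1) else 0\<^sub>v n)"
  have Pc: "col P j \<in> carrier_vec n" for j using P by (auto simp: col_def)
  have Cc: "C *\<^sub>v col P j = unit_vec n j" if "j < n" for j
    using PC(2) col_mult2[OF C P that] that by simp
  have C0: "C *\<^sub>v 0\<^sub>v n = 0\<^sub>v n" using C by auto
  have Cr: "C *\<^sub>v ?r = lam k \<cdot>\<^sub>v unit_vec n k + (if 0 < k \<and> S (k - 1) then unit_vec n (k - 1) else 0\<^sub>v n)"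
    using Pc k C Cc C0 by (auto simp: mult_add_distrib_mat_vec[OF C] mult_mat_vec[OF C])
  have r: "?r \<in> carrier_vec n" using Pc by auto
  have Ap: "A *\<^sub>v col P k \<in> carrier_vec n" using A Pc by auto
  have "C *\<^sub>v (A *\<^sub>v col P k) = C *\<^sub>v ?r"
  proof (rule eq_vecI)
    fix j assume "j < dim_vec (C *\<^sub>v ?r)"
    then have j: "j < n" using C by simp
    show "(C *\<^sub>v (A *\<^sub>v col P k)) $ j = (C *\<^sub>v ?r) $ j"
      unfolding Cr act[OF Pc j] Cc[OF k] using j k S[of j] by auto
  qed (use C in auto)
  then have "P *\<^sub>v (C *\<^sub>v (A *\<^sub>v col P k)) = P *\<^sub>v (C *\<^sub>v ?r)" by simp
  then show "A *\<^sub>v col P k = ?r"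
    using assoc_mult_mat_vec[OF P C r] assoc_mult_mat_vec[OF P C Ap] PC(1) r Ap by simp
  show "col P k \<noteq> 0\<^sub>v n"
    using Cc[OF k] C0 k by (metis unit_vec_nonzero)
qed

text \<open>The kernel condition is about real vectors but is applied to complex Jordan vectors; as
  \<open>A\<close> is real, it applies to real and imaginary parts separately.\<close>

lemma cmat_cube_kernel:
  assumes A: "A \<in> carrier_mat n n" and ker: "mat_kernel (A ^\<^sub>m 3) = mat_kernel (A ^\<^sub>m 2)"
    and v: "v \<in> carrier_vec n" and 0: "cmat A *\<^sub>v (cmat A *\<^sub>v (cmat A *\<^sub>v v)) = 0\<^sub>v n"
  shows "cmat A *\<^sub>v (cmat A *\<^sub>v v) = 0\<^sub>v n"
proof -
  have cA: "cmat A \<in> carrier_mat n n" using A by simp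
  have Av: "cmat A *\<^sub>v v \<in> carrier_vec n" and AAv: "cmat A *\<^sub>v (cmat A *\<^sub>v v) \<in> carrier_vec n"
    and AAAv: "cmat A *\<^sub>v (cmat A *\<^sub>v (cmat A *\<^sub>v v)) \<in> carrier_vec n"
    using cA v by auto
  have real: "A *\<^sub>v (A *\<^sub>v x) = 0\<^sub>v n"
    if x: "x \<in> carrier_vec n" and "A *\<^sub>v (A *\<^sub>v (A *\<^sub>v x)) = 0\<^sub>v n" for x
  proof -
    have "x \<in> mat_kernel (A ^\<^sub>m 3)"
      using that A by (simp add: mat_kernel[of _ n n] pow_mat_three[OF A] assoc_mult_mat_vec[of _ n n _ n])
    then have "x \<in> mat_kernel (A ^\<^sub>m 2)" unfolding ker .
    then show ?thesis
      using A x by (simp add: mat_kernel[of _ n n] pow_mat_two[OF A] assoc_mult_mat_vec[of _ n n _ n])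
  qed
  show ?thesis
    using 0 v real[of "map_vec Re v"] real[of "map_vec Im v"]
    unfolding complex_vec_eq_0_iff[OF AAv] complex_vec_eq_0_iff[OF AAAv]
      Re_cmat_mult_vec[OF A AAv] Re_cmat_mult_vec[OF A Av] Re_cmat_mult_vec[OF A v]
      Im_cmat_mult_vec[OF A AAv] Im_cmat_mult_vec[OF A Av] Im_cmat_mult_vec[OF A v]
    by simp
qed

lemma minimal_index:
  fixes k :: nat
  assumes "Q k"
  obtains m where "m \<le> k" "Q m" "0 < m \<Longrightarrow> \<not> Q (m - 1)"
proof
  show "(LEAST m. Q m) \<le> k" using assms by (rule Least_le)
  show "Q (LEAST m. Q m)" using assms by (rule LeastI)
  show "\<not> Q ((LEAST m. Q m) - 1)" if "0 < (LEAST m. Q m)"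
    using that by (intro not_less_Least) simp
qed

text \<open>Each forbidden link yields a basis vector violating a kernel condition: the second
  vector of a chain at i \<alpha> is killed by the square of A - i \<alpha> only, the third vector
  of a chain at 0 by A^3 but not by A^2.\<close>

lemma jordan_chain_basis_kernel_conditions:
  fixes A :: "real mat"
  assumes A: "A \<in> carrier_mat n n"
    and spec: "spectrum (cmat A) \<subseteq> {z. Re z \<le> 0}"
    and imag: "\<And>\<alpha>. \<alpha> \<noteq> 0 \<Longrightarrow> mat_kernel (shift_mat n A \<alpha> ^\<^sub>m 2) = mat_kernel (shift_mat n A \<alpha>)"
    and zero: "mat_kernel (A ^\<^sub>m 3) = mat_kernel (A ^\<^sub>m 2)"
  obtains C P and lam :: "nat \<Rightarrow> complex" and S
  where "C \<in> carrier_mat n n" "P \<in> carrier_mat n n" "P * C = 1\<^sub>m n"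
    and "\<And>x k. x \<in> carrier_vec n \<Longrightarrow> k < n \<Longrightarrow> (C *\<^sub>v (cmat A *\<^sub>v x)) $ k =
      lam k * (C *\<^sub>v x) $ k + (if S k then (C *\<^sub>v x) $ Suc k else 0)"
    and "\<And>k. S k \<Longrightarrow> Suc k < n \<and> lam (Suc k) = lam k"
    and "\<And>k. k < n \<Longrightarrow> Re (lam k) \<le> 0"
    and "\<And>k. S k \<Longrightarrow> Re (lam k) = 0 \<Longrightarrow> lam k = 0"
    and "\<And>k. S k \<Longrightarrow> S (Suc k) \<Longrightarrow> lam k \<noteq> 0"
proof -
  have cA: "cmat A \<in> carrier_mat n n" using A by simp
  from jordan_chain_basis[OF cA] obtain lam S C P
    where C: "C \<in> carrier_mat n n" and P: "P \<in> carrier_mat n n"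
      and PC: "P * C = 1\<^sub>m n" "C * P = 1\<^sub>m n"
      and S: "\<And>k. S k \<Longrightarrow> Suc k < n \<and> lam (Suc k) = lam k"
      and act: "\<And>x k. x \<in> carrier_vec n \<Longrightarrow> k < n \<Longrightarrow> (C *\<^sub>v (cmat A *\<^sub>v x)) $ k =
        lam k * (C *\<^sub>v x) $ k + (if S k then (C *\<^sub>v x) $ Suc k else 0)" by metis
  define p where "p = col P"
  have p: "p k \<in> carrier_vec n" for k using P by (auto simp: p_def col_def)
  have Sn: "Suc k < n" if "S k" for k using S that by blast
  have p_nz: "p k \<noteq> 0\<^sub>v n" if "k < n" for k
    using jordan_chain_basis_column(2)[OF cA C P PC act Sn that] by (simp add: p_def)
  have p_first: "cmat A *\<^sub>v p k = lam k \<cdot>\<^sub>v p k" if "k < n" "0 < k \<Longrightarrow> \<not> S (k - 1)" for k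
    using jordan_chain_basis_column(1)[OF cA C P PC act Sn that(1)] that(2) p[of k] by (auto simp: p_def)
  have p_next: "cmat A *\<^sub>v p (Suc k) = lam k \<cdot>\<^sub>v p (Suc k) + p k" if "S k" for k
    using jordan_chain_basis_column(1)[OF cA C P PC act Sn, of "Suc k"] that S[OF that] by (auto simp: p_def)
  have lam_pred: "lam (k - 1) = lam k" if "0 < k" "S (k - 1)" for k using S[OF that(2)] that(1) by simp
  have re: "Re (lam k) \<le> 0" if "k < n" for k
  proof -
    obtain m where m: "m \<le> k" "lam m = lam k" "0 < m \<Longrightarrow> lam (m - 1) \<noteq> lam k"
      using minimal_index[of "\<lambda>m. lam m = lam k" k] by blast
    have "eigenvector (cmat A) (p m) (lam k)"
      using p_first[of m] m lam_pred[of m] p[of m] p_nz[of m] that A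
      unfolding eigenvector_def by auto
    then have "lam k \<in> spectrum (cmat A)" unfolding spectrum_def eigenvalue_def by blast
    then show ?thesis using spec by auto
  qed
  have im: "lam k = 0" if k: "S k" "Re (lam k) = 0" for k
  proof (rule ccontr)
    assume nz: "lam k \<noteq> 0"
    \<comment> \<open>Minimality makes \<open>p m\<close> a genuine eigenvector: links preserve the
      eigenvalue, so a link at \<open>m - 1\<close> would satisfy the same predicate.\<close>
    obtain m where m: "S m" "lam m = lam k" "0 < m \<Longrightarrow> \<not> (S (m - 1) \<and> lam (m - 1) = lam k)"
      using minimal_index[of "\<lambda>m. S m \<and> lam m = lam k" k] k by blast
    define \<alpha> where "\<alpha> = Im (lam k)"
    have z: "lam k = \<i> * complex_of_real \<alpha>" and \<alpha>: "\<alpha> \<noteq> 0"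
      using k(2) nz by (auto simp: complex_eq_iff \<alpha>_def)
    have Apm: "cmat A *\<^sub>v p m = (\<i> * complex_of_real \<alpha>) \<cdot>\<^sub>v p m"
      using p_first[of m] m S[OF m(1)] lam_pred[of m] z by auto
    have Apm1: "cmat A *\<^sub>v p (Suc m) - (\<i> * complex_of_real \<alpha>) \<cdot>\<^sub>v p (Suc m) = p m"
      using p_next[OF m(1)] p[of m] p[of "Suc m"] unfolding m(2) z
      by (intro eq_vecI) auto
    have "p (Suc m) \<in> mat_kernel (shift_mat n A \<alpha> ^\<^sub>m 2)"
      unfolding shift_mat_sq_kernel[OF A] using Apm Apm1 p[of "Suc m"] by simp
    then have "p (Suc m) \<in> mat_kernel (shift_mat n A \<alpha>)" using imag[OF \<alpha>] by simp
    then have "cmat A *\<^sub>v p (Suc m) = (\<i> * complex_of_real \<alpha>) \<cdot>\<^sub>v p (Suc m)"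
      unfolding shift_mat_kernel[OF A] by simp
    then have "p m = 0\<^sub>v n" using Apm1 p[of "Suc m"] by (auto simp: minus_vec_eq_0_iff[of _ n])
    then show False using p_nz[of m] Sn[OF m(1)] by simp
  qed
  have nil: "lam k \<noteq> 0" if k: "S k" "S (Suc k)" for k
  proof
    assume "lam k = 0"
    then obtain m where m: "S m" "S (Suc m)" "lam m = 0" "0 < m \<Longrightarrow> \<not> (S (m - 1) \<and> S m \<and> lam (m - 1) = 0)"
      using minimal_index[of "\<lambda>m. S m \<and> S (Suc m) \<and> lam m = 0" k] k
      by (metis Suc_pred')
    have zs: "(0 :: complex) \<cdot>\<^sub>v p j = 0\<^sub>v n" for j using zero_smult_vec[OF p] .
    have Ap0: "cmat A *\<^sub>v p m = 0\<^sub>v n"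
      using p_first[of m] m S[OF m(1)] lam_pred[of m] zs by auto
    have Ap1: "cmat A *\<^sub>v p (Suc m) = p m"
      using p_next[OF m(1)] m(3) zs p[of m] by simp
    have Ap2: "cmat A *\<^sub>v p (Suc (Suc m)) = p (Suc m)"
      using p_next[OF m(2)] m(3) S[OF m(1)] zs p[of "Suc m"] by simp
    have "p m = 0\<^sub>v n"
      using cmat_cube_kernel[OF A zero p[of "Suc (Suc m)"]] Ap0 Ap1 Ap2 by simp
    then show False using p_nz[of m] Sn[OF m(1)] by simp
  qed
  from that[OF C P PC(1) act S re im nil] show thesis .
qed

section \<open>Sufficiency: the weighted Gram matrix\<close>

text \<open>This is the entrywise real part of C^* diag(w) C. It gives a real \<open>Q\<close> from
  a complex Jordan basis without matching conjugate chains, since on real vectors its form is the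
  real part of the Hermitian one.\<close>

definition weighted_gram :: "nat \<Rightarrow> (nat \<Rightarrow> real) \<Rightarrow> complex mat \<Rightarrow> real mat" where
  "weighted_gram n w C = mat n n (\<lambda>(i, j). \<Sum>k = 0..<n. w k * Re (cnj (C $$ (k, i)) * C $$ (k, j)))"

lemma weighted_gram_form:
  assumes C: "C \<in> carrier_mat n n" and x: "x \<in> carrier_vec n" and y: "y \<in> carrier_vec n"
  shows "x \<bullet> (weighted_gram n w C *\<^sub>v y) =
    (\<Sum>k = 0..<n. w k * Re (cnj ((C *\<^sub>v cvec x) $ k) * (C *\<^sub>v cvec y) $ k))"
proof -
  have C_app: "(C *\<^sub>v cvec z) $ k = (\<Sum>i = 0..<n. C $$ (k, i) * complex_of_real (z $ i))"
    if "k < n" "z \<in> carrier_vec n" for k z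
    using that C by (auto simp: scalar_prod_def)
  have summand: "w k * Re (cnj ((C *\<^sub>v cvec x) $ k) * (C *\<^sub>v cvec y) $ k) =
      (\<Sum>i = 0..<n. \<Sum>j = 0..<n. w k * Re (cnj (C $$ (k, i)) * C $$ (k, j)) * x $ i * y $ j)"
    if "k < n" for k
    unfolding C_app[OF that x] C_app[OF that y] cnj_sum sum_product
    unfolding Re_sum sum_distrib_left
    by (intro sum.cong) (auto simp: algebra_simps)
  have "x \<bullet> (weighted_gram n w C *\<^sub>v y) = (\<Sum>i = 0..<n. \<Sum>j = 0..<n. \<Sum>k = 0..<n.
      w k * Re (cnj (C $$ (k, i)) * C $$ (k, j)) * x $ i * y $ j)"
    using x y unfolding scalar_prod_def weighted_gram_def
    by (auto simp: scalar_prod_def sum_distrib_left sum_distrib_right mult_ac simp del: times_complex.sel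
        intro!: sum.cong)
  also have "\<dots> = (\<Sum>i = 0..<n. \<Sum>k = 0..<n. \<Sum>j = 0..<n.
      w k * Re (cnj (C $$ (k, i)) * C $$ (k, j)) * x $ i * y $ j)"
    by (intro sum.cong refl sum.swap)
  also have "\<dots> = (\<Sum>k = 0..<n. \<Sum>i = 0..<n. \<Sum>j = 0..<n.
      w k * Re (cnj (C $$ (k, i)) * C $$ (k, j)) * x $ i * y $ j)"
    by (rule sum.swap)
  also have "\<dots> = (\<Sum>k = 0..<n. w k * Re (cnj ((C *\<^sub>v cvec x) $ k) * (C *\<^sub>v cvec y) $ k))"
    using summand by (intro sum.cong) auto
  finally show ?thesis .
qed

lemma Re_cnj_mult_self: "Re (cnj z * z) = (cmod z)\<^sup>2"
  unfolding cmod_power2 by (simp add: power2_eq_square)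

lemma weighted_gram_psd:
  assumes C: "C \<in> carrier_mat n n" and w: "\<And>k. 0 \<le> w k"
  shows "sym_pos_semidef n (weighted_gram n w C)"
  unfolding sym_pos_semidef_def symmetric_mat_def
proof (intro conjI ballI)
  show "(weighted_gram n w C)\<^sup>T = weighted_gram n w C"
    by (rule eq_matI) (auto simp: weighted_gram_def mult_ac intro!: sum.cong)
  fix x :: "real vec" assume x: "x \<in> carrier_vec n"
  show "0 \<le> x \<bullet> (weighted_gram n w C *\<^sub>v x)"
    unfolding weighted_gram_form[OF C x x] Re_cnj_mult_self by (intro sum_nonneg) (simp add: w)
qed (simp add: weighted_gram_def)

text \<open>Half of the decay - r |a|^2 is spent on the cross term: |a| |b| \<le> r/2 |a|^2 + |b|^2
  / (2 r), and 1 \<le> K r^2 bounds the last term by K r/2 |b|^2, half the decay of the next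
  coordinate at a weight \<open>K\<close> times larger.\<close>

lemma jordan_link_dissipation:
  fixes a b :: complex and r K :: real
  assumes r: "0 < r" and K: "1 \<le> K * r\<^sup>2"
  shows "- r * (cmod a)\<^sup>2 + Re (cnj a * b) \<le> K * (r / 2 * (cmod b)\<^sup>2) - r / 2 * (cmod a)\<^sup>2"
proof -
  let ?a = "cmod a" and ?b = "cmod b"
  have "2 * r * (?a * ?b) \<le> (r * ?a)\<^sup>2 + ?b\<^sup>2"
    using sum_squares_bound[of "r * ?a" ?b] by (simp add: mult_ac)
  also have "\<dots> \<le> (r * ?a)\<^sup>2 + K * r\<^sup>2 * ?b\<^sup>2"
    using mult_right_mono[OF K, of "?b\<^sup>2"] by simp
  finally have "r * (?a * ?b) \<le> r * (r / 2 * ?a\<^sup>2 + K * (r / 2 * ?b\<^sup>2))"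
    by (simp add: power2_eq_square field_simps)
  then have "?a * ?b \<le> r / 2 * ?a\<^sup>2 + K * (r / 2 * ?b\<^sup>2)" using r by simp
  moreover have "Re (cnj a * b) \<le> ?a * ?b"
    using complex_Re_le_cmod[of "cnj a * b"] by (simp add: norm_mult)
  ultimately show ?thesis by (simp add: field_simps)
qed

text \<open>The weights of \<open>Q\<close> vanish exactly on the coordinates that neither carry a nonzero eigenvalue
  nor are the target of a link; they grow geometrically along each block, so that the
  cross term of a link is absorbed by the decay of the next coordinate.\<close>

lemma kernel_conditions_imp_dissipative_Hamiltonian:
  fixes A :: "real mat"
  assumes A: "A \<in> carrier_mat n n"
    and spec: "spectrum (cmat A) \<subseteq> {z. Re z \<le> 0}"
    and imag: "\<And>\<alpha>. \<alpha> \<noteq> 0 \<Longrightarrow> mat_kernel (shift_mat n A \<alpha> ^\<^sub>m 2) = mat_kernel (shift_mat n A \<alpha>)"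
    and zero: "mat_kernel (A ^\<^sub>m 3) = mat_kernel (A ^\<^sub>m 2)"
  shows "dissipative_Hamiltonian n A"
proof (rule jordan_chain_basis_kernel_conditions[OF A spec imag zero])
  fix C P :: "complex mat" and lam :: "nat \<Rightarrow> complex" and S :: "nat \<Rightarrow> bool"
  assume C: "C \<in> carrier_mat n n" and P: "P \<in> carrier_mat n n" and PC: "P * C = 1\<^sub>m n"
      and act: "\<And>x k. x \<in> carrier_vec n \<Longrightarrow> k < n \<Longrightarrow> (C *\<^sub>v (cmat A *\<^sub>v x)) $ k =
        lam k * (C *\<^sub>v x) $ k + (if S k then (C *\<^sub>v x) $ Suc k else 0)"
      and S: "\<And>k. S k \<Longrightarrow> Suc k < n \<and> lam (Suc k) = lam k"
      and re: "\<And>k. k < n \<Longrightarrow> Re (lam k) \<le> 0"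
      and im: "\<And>k. S k \<Longrightarrow> Re (lam k) = 0 \<Longrightarrow> lam k = 0"
      and nil: "\<And>k. S k \<Longrightarrow> S (Suc k) \<Longrightarrow> lam k \<noteq> 0"
  \<comment> \<open>The sum dominates each 1 / (Re lambda)^2, with imaginary eigenvalues
    contributing 1/0 = 0; the summand 1 keeps \<open>K\<close> positive.\<close>
  define K where "K = 1 + (\<Sum>k = 0..<n. 1 / (Re (lam k))\<^sup>2)"
  have K0: "0 < K" unfolding K_def by (intro add_pos_nonneg sum_nonneg) auto
  have K: "1 \<le> K * (Re (lam k))\<^sup>2" if "k < n" "Re (lam k) \<noteq> 0" for k
  proof -
    have "1 / (Re (lam k))\<^sup>2 \<le> (\<Sum>k = 0..<n. 1 / (Re (lam k))\<^sup>2)"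
      using that(1) by (intro member_le_sum) auto
    then have "1 / (Re (lam k))\<^sup>2 \<le> K" by (simp add: K_def)
    then show ?thesis using that(2) by (simp add: divide_le_eq)
  qed
  define w where "w k = (if lam k \<noteq> 0 \<or> 0 < k \<and> S (k - 1) then K ^ k else 0)" for k
  have w0: "0 \<le> w k" for k using K0 by (simp add: w_def)
  define Q where "Q = weighted_gram n w C"
  have psd: "sym_pos_semidef n Q" unfolding Q_def by (rule weighted_gram_psd[OF C w0])
  note QD = sym_pos_semidefD[OF psd]
  have CA: "(C *\<^sub>v cvec (A *\<^sub>v x)) $ k =
      lam k * (C *\<^sub>v cvec x) $ k + (if S k then (C *\<^sub>v cvec x) $ Suc k else 0)"
    if "x \<in> carrier_vec n" "k < n" for x k
    using act[of "cvec x" k] cmat_mult_cvec[OF A that(1)] that by simp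
  show ?thesis
  proof (rule dissipative_HamiltonianI[OF A psd])
    fix x :: "real vec" assume x: "x \<in> carrier_vec n"
    have Ax: "A *\<^sub>v x \<in> carrier_vec n" using A x by auto
    define c where "c k = (C *\<^sub>v cvec x) $ k" for k
    {
      assume "Q *\<^sub>v x = 0\<^sub>v n"
      then have "x \<bullet> (Q *\<^sub>v x) = 0" using x by simp
      then have "(\<Sum>k = 0..<n. w k * (cmod (c k))\<^sup>2) = 0"
        unfolding Q_def weighted_gram_form[OF C x x] Re_cnj_mult_self c_def .
      then have wc: "w k = 0 \<or> c k = 0" if "k < n" for k
        using that w0 by (subst (asm) sum_nonneg_eq_0_iff) auto
      \<comment> \<open>\<open>A\<close> reads coordinate \<open>k\<close> only through a nonzero
        eigenvalue and \<open>k + 1\<close> only through a link; both cases carry positive weight,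
        so these coordinates are zero.\<close>
      have "C *\<^sub>v cvec (A *\<^sub>v x) = 0\<^sub>v n"
      proof (rule eq_vecI)
        fix k assume "k < dim_vec (0\<^sub>v n :: complex vec)"
        then have k: "k < n" by simp
        have "lam k = 0 \<or> c k = 0" using wc[OF k] K0 by (auto simp: w_def split: if_splits)
        moreover have "c (Suc k) = 0" if "S k" using wc[of "Suc k"] S[OF that] that K0 by (auto simp: w_def split: if_splits)
        ultimately show "(C *\<^sub>v cvec (A *\<^sub>v x)) $ k = 0\<^sub>v n $ k"
          using CA[OF x k] k by (auto simp: c_def)
      qed (use C in auto)
      then have "P *\<^sub>v (C *\<^sub>v cvec (A *\<^sub>v x)) = 0\<^sub>v n" using P by auto
      moreover have "P *\<^sub>v (C *\<^sub>v cvec (A *\<^sub>v x)) = cvec (A *\<^sub>v x)"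
        using assoc_mult_mat_vec[OF P C, of "cvec (A *\<^sub>v x)"] PC Ax by simp
      ultimately show "A *\<^sub>v x = 0\<^sub>v n" using cvec_eq_0_iff by metis
    }
    \<comment> \<open>Half the decay of coordinate \<open>k\<close>, held back to absorb the link
      arriving from \<open>k - 1\<close>. The default \<open>D n = 0\<close> makes the telescoping
      sum end at \<open>- D 0\<close>.\<close>
    define D where "D k = (if k < n then K ^ k * (- Re (lam k) / 2 * (cmod (c k))\<^sup>2) else 0)" for k
    have D0: "0 \<le> D k" for k using re[of k] K0 by (auto simp: D_def mult_nonneg_nonpos mult_nonpos_nonneg)
    have step: "w k * Re (cnj (c k) * (lam k * c k + (if S k then c (Suc k) else 0))) \<le> D (Suc k) - D k"
      if k: "k < n" for k
    proof -
      have summand: "w k * Re (cnj (c k) * (lam k * c k + (if S k then c (Suc k) else 0))) =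
          w k * (Re (lam k) * (cmod (c k))\<^sup>2 + (if S k then Re (cnj (c k) * c (Suc k)) else 0))"
        unfolding cmod_power2 by (simp add: power2_eq_square algebra_simps)
      have Dk: "D k = K ^ k * (- Re (lam k) / 2 * (cmod (c k))\<^sup>2)" using k by (simp add: D_def)
      consider "lam k = 0" | "lam k \<noteq> 0" "Re (lam k) = 0" | "Re (lam k) < 0" "\<not> S k" | "Re (lam k) < 0" "S k"
        using re[OF k] by linarith
      then have "w k * (Re (lam k) * (cmod (c k))\<^sup>2 + (if S k then Re (cnj (c k) * c (Suc k)) else 0))
          \<le> D (Suc k) - K ^ k * (- Re (lam k) / 2 * (cmod (c k))\<^sup>2)"
      proof cases
        case 1
        \<comment> \<open>At eigenvalue 0 positive weight means that a link arrives at
          \<open>k\<close>; another one leaving it would make a chain of three.\<close>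
        have "w k = 0 \<or> \<not> S k" using 1 nil[of "k - 1"] S[of "k - 1"] by (auto simp: w_def)
        with 1 show ?thesis
          using D0[of "Suc k"] by auto
      next
        case 2
        then have "\<not> S k" using im by blast
        with 2 show ?thesis
          using D0[of "Suc k"] by simp
      next
        case 3
        define e where "e = K ^ k * (Re (lam k) * (cmod (c k))\<^sup>2)"
        have "e \<le> 0"
          unfolding e_def using 3 K0 by (intro mult_nonneg_nonpos mult_nonpos_nonneg) auto
        moreover have "K ^ k * (- Re (lam k) / 2 * (cmod (c k))\<^sup>2) = - e / 2" by (simp add: e_def)
        moreover have "w k = K ^ k" using 3 by (auto simp: w_def)
        ultimately show ?thesis using 3 D0[of "Suc k"] by (simp add: e_def[symmetric])
      next
        case 4
        have "w k = K ^ k" using 4 by (auto simp: w_def)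
        moreover have "K ^ k * (- (- Re (lam k)) * (cmod (c k))\<^sup>2 + Re (cnj (c k) * c (Suc k)))
            \<le> K ^ k * (K * (- Re (lam k) / 2 * (cmod (c (Suc k)))\<^sup>2) - (- Re (lam k) / 2 * (cmod (c k))\<^sup>2))"
          using 4 K[OF k] K0 by (intro mult_left_mono jordan_link_dissipation) auto
        \<comment> \<open>The eigenvalue is the same on both ends of the link, so the only change is
          the additional factor \<open>K\<close>.\<close>
        moreover have "D (Suc k) = K ^ k * (K * (- Re (lam k) / 2 * (cmod (c (Suc k)))\<^sup>2))"
          using S[OF 4(2)] by (simp add: D_def)
        ultimately show ?thesis
          using 4(2) by (simp only: if_True minus_minus right_diff_distrib)
      qed
      then show ?thesis unfolding summand Dk .
    qed
    have "(Q *\<^sub>v x) \<bullet> (A *\<^sub>v x) = x \<bullet> (Q *\<^sub>v (A *\<^sub>v x))"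
      using transpose_vec_mult_scalar[OF QD(1) Ax x] QD(2) by simp
    also have "\<dots> = (\<Sum>k = 0..<n. w k * Re (cnj (c k) * (lam k * c k + (if S k then c (Suc k) else 0))))"
      unfolding Q_def weighted_gram_form[OF C x Ax] c_def using CA[OF x] by (intro sum.cong) auto
    also have "\<dots> \<le> (\<Sum>k = 0..<n. D (Suc k) - D k)" using step by (intro sum_mono) auto
    also have "\<dots> = D n - D 0" by (rule sum_Suc_diff') simp
    also have "\<dots> \<le> 0" using D0[of 0] by (simp add: D_def)
    finally show "(Q *\<^sub>v x) \<bullet> (A *\<^sub>v x) \<le> 0" .
  qed
qed

theorem theoremB2:
  fixes n :: nat and A :: "real mat"
  assumes "A \<in> carrier_mat n n"
  shows
    "(dissipative_Hamiltonian n A \<longleftrightarrow>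
       spectrum (cmat A) \<subseteq> {z. Re z \<le> 0} \<and>
       (\<forall>\<alpha>::real. \<alpha> \<noteq> 0 \<longrightarrow>
          mat_kernel (shift_mat n A \<alpha> ^\<^sub>m 2) = mat_kernel (shift_mat n A \<alpha>)) \<and>
       mat_kernel (A ^\<^sub>m 3) = mat_kernel (A ^\<^sub>m 2))
     \<and>
     (\<forall>J R Q. dH_decomposition n A J R Q \<longrightarrow>
       (\<forall>\<alpha>::real. \<alpha> \<noteq> 0 \<longrightarrow>
          mat_kernel (shift_mat n A \<alpha> ^\<^sub>m 2) = mat_kernel (shift_mat n A \<alpha>) \<and>
          mat_kernel (shift_mat n A \<alpha>) =
            mat_kernel (shift_mat n (J * Q) \<alpha>) \<inter> mat_kernel (cmat (R * Q))) \<and>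
       mat_kernel A = mat_kernel (J * Q) \<inter> mat_kernel (R * Q) \<and>
       mat_kernel (A ^\<^sub>m 3) = mat_kernel (A ^\<^sub>m 2) \<and>
       mat_kernel (A ^\<^sub>m 2) = mat_kernel (Q * J * Q) \<inter> mat_kernel (R * Q))"
proof (intro conjI)
  show "dissipative_Hamiltonian n A \<longleftrightarrow>
       spectrum (cmat A) \<subseteq> {z. Re z \<le> 0} \<and>
       (\<forall>\<alpha>::real. \<alpha> \<noteq> 0 \<longrightarrow>
          mat_kernel (shift_mat n A \<alpha> ^\<^sub>m 2) = mat_kernel (shift_mat n A \<alpha>)) \<and>
       mat_kernel (A ^\<^sub>m 3) = mat_kernel (A ^\<^sub>m 2)" (is "_ \<longleftrightarrow> ?conditions")
  proof
    assume "dissipative_Hamiltonian n A"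
    then obtain J R Q where dH: "dH_decomposition n A J R Q"
      unfolding dissipative_Hamiltonian_def by blast
    show ?conditions
      using dH_spectrum[OF dH] dH_kernels(1,4)[OF dH] by blast
  next
    assume ?conditions
    then show "dissipative_Hamiltonian n A"
      using kernel_conditions_imp_dissipative_Hamiltonian[OF assms] by blast
  qed
  show "\<forall>J R Q. dH_decomposition n A J R Q \<longrightarrow>
       (\<forall>\<alpha>::real. \<alpha> \<noteq> 0 \<longrightarrow>
          mat_kernel (shift_mat n A \<alpha> ^\<^sub>m 2) = mat_kernel (shift_mat n A \<alpha>) \<and>
          mat_kernel (shift_mat n A \<alpha>) =
            mat_kernel (shift_mat n (J * Q) \<alpha>) \<inter> mat_kernel (cmat (R * Q))) \<and>
       mat_kernel A = mat_kernel (J * Q) \<inter> mat_kernel (R * Q) \<and>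
       mat_kernel (A ^\<^sub>m 3) = mat_kernel (A ^\<^sub>m 2) \<and>
       mat_kernel (A ^\<^sub>m 2) = mat_kernel (Q * J * Q) \<inter> mat_kernel (R * Q)"
    by (intro allI impI conjI; rule dH_kernels; assumption)
qed

end
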